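(* Let $\mathcal{M}=(S,A,T,\beta,\Lambda,L)$ be a labeled Markov decision process, let $\phi,\psi$ be co-safe LTL specifications, let $\tau$ be a constraint threshold, let $\mathcal{A}_\phi,\mathcal{A}_\psi$ be DFAs representing $\phi$ and $\psi$, and let $\mathcal{M}^\times$ be the double product MDP of $\mathcal{M},\mathcal{A}_\phi,\mathcal{A}_\psi$, with target sets $Z_\phi^\times,Z_\psi^\times$. The optimal non-Markovian policy for the constrained sc-LTL problem on the MDP $\mathcal{M}$, $$\max_{\pi} P_{\pi}(\sigma\models\phi)\quad\text{s.t.}\quad P_{\pi}(\sigma\models\psi)\ge\tau ,$$ can be recovered from the optimal stationary policy for the constrained reachability problem on the double product MDP $\mathcal{M}^\times$, $$\max_{\pi^\times} P_{\pi^\times}(\sigma^\times\models\lozenge Z_\phi^\times)\quad\text{s.t.}\quad P_{\pi^\times}(\sigma^\times\models\lozenge Z_\psi^\times)\ge\tau .$$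
   Context: A labeled Markov decision process (LMDP) is a tuple $\mathcal{M}=(S,A,T,\beta,\Lambda,L)$: $S$ is a finite set of states; $A$ is a finite set of actions, with $A(s)$ the set of allowed actions in state $s$; $T:S\times A\times S\to[0,1]$ satisfies $\sum_{s'}T(s,a,s')=1$ if $a\in A(s)$ and $=0$ if $a\notin A(s)$; $\beta$ is a probability distribution on $S$ (the initial distribution); $\Lambda$ is a finite set of atomic propositions; $L:S\to2^\Lambda$ is a labeling function. A policy maps each finite state-action prefix $h_t=(s_0,a_0,\ldots,s_t)$ and the time step $t$ to a probability distribution on $A(s_t)$. It is stationary if its input is restricted to the current state $s_t$, Markovian if its input is restricted to $s_t$ and $t$, and non-Markovian otherwise. A policy $\pi$ induces a probability measure $P_\pi$ on infinite trajectories: $s_0\sim\beta$, $a_t\sim\pi(h_t,t)$, $s_{t+1}\sim T(s_t,a_t,\cdot)$. A path $\sigma$ is the infinite state sequence $s_0s_1s_2\cdots$; for a set of states $Y$, $\sigma\models\lozenge Y$ means $s_t\in Y$ for some $t\ge0$. The maximum in each problem is over all policies on the respective MDP. LTL specifications over $\Lambda$ are given by $\varphi::=\mathrm{true}\mid\alpha\mid\varphi_1\wedge\varphi_2\mid\neg\varphi\mid\bigcirc\varphi\mid\varphi_1\,\mathcal{U}\,\varphi_2$ with $\alpha\in\Lambda$, with the standard semantics, evaluated on a path $\sigma$ through its label sequence $L(\sigma)=L(s_0)L(s_1)\cdots$. A specification $\varphi$ is co-safe (sc-LTL) if every infinite sequence satisfying $\varphi$ has a finite prefix such that every infinite continuation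 of that prefix satisfies $\varphi$. A deterministic finite automaton (DFA) $(Q,\Sigma,\delta,q_{\mathrm{init}},Z)$ has a finite state set $Q$, a finite alphabet $\Sigma$, a (partial) transition function $\delta:Q\times\Sigma\to Q$, an initial state $q_{\mathrm{init}}\in Q$ and a set of final states $Z\subseteq Q$. A path $\sigma$ is accepted by a DFA with alphabet $2^\Lambda$ if, for some $t$, the labels of the prefix $s_0s_1\cdots s_t$ move $q_{\mathrm{init}}$ to a state in $Z$. A DFA $\mathcal{A}_\varphi$ with alphabet $2^\Lambda$ represents an sc-LTL specification $\varphi$ if $\sigma\models\varphi$ if and only if $\sigma$ is accepted by $\mathcal{A}_\varphi$; its accepting (final) states are absorbing. Write $\mathcal{A}_\phi=(Q_\phi,\Sigma_\phi,\delta_\phi,q_{\mathrm{init},\phi},Z_\phi)$ and $\mathcal{A}_\psi=(Q_\psi,\Sigma_\psi,\delta_\psi,q_{\mathrm{init},\psi},Z_\psi)$, with $\Sigma_\phi=\Sigma_\psi=2^\Lambda$. The double product MDP $\mathcal{M}^\times$ of $\mathcal{M}$, $\mathcal{A}_\phi$, $\mathcal{A}_\psi$ has: state set $S\times Q_\phi\times Q_\psi$; action set $A$, with allowed actions $A(s)$ at $\langle s,q_\phi,q_\psi\rangle$; target sets $Z_\phi^\times=\{\langle s,q_\phi,q_\psi\rangle: q_\phi\in Z_\phi\}$ and $Z_\psi^\times=\{\langle s,q_\phi,q_\psi\rangle: q_\psi\in Z_\psi\}$; initial distribution $\beta^\times(\langle s,q_{\mathrm{init},\phi},q_{\mathrm{init},\psi}\rangle)=\beta(s)$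 for all $s\in S$ and $0$ elsewhere; and transition probabilities $T^\times(\langle s,q_\phi,q_\psi\rangle,a,\langle s',q_\phi',q_\psi'\rangle)=T(s,a,s')$ if $q_\phi'=\delta_\phi(q_\phi,L(s))$ and $q_\psi'=\delta_\psi(q_\psi,L(s))$, and $0$ otherwise. Policies $\pi^\times$, paths $\sigma^\times$ and path measures $P_{\pi^\times}$ on $\mathcal{M}^\times$ are defined as for $\mathcal{M}$. *)

theory Defs
  imports "HOL-Probability.Probability"
begin

section \<open>Markov decision processes and policies\<close>

record ('s, 'a) mdp =
  states :: "'s set"
  acts :: "'a set"
  allowed :: "'s \<Rightarrow> 'a set"
  trans :: "'s \<Rightarrow> 'a \<Rightarrow> 's \<Rightarrow> real"
  init :: "'s \<Rightarrow> real"

record ('s, 'a, 'p) lmdp = "('s, 'a) mdp" +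
  props :: "'p set"
  label :: "'s \<Rightarrow> 'p set"

definition is_mdp :: "('s, 'a, 'm) mdp_scheme \<Rightarrow> bool" where
  "is_mdp M \<longleftrightarrow>
     finite (states M) \<and> finite (acts M) \<and>
     (\<forall>s\<in>states M. allowed M s \<subseteq> acts M) \<and>
     (\<forall>s\<in>states M. \<forall>a\<in>acts M. \<forall>s'\<in>states M. trans M s a s' \<in> {0..1}) \<and>
     (\<forall>s\<in>states M. \<forall>a\<in>acts M.
        (\<Sum>s'\<in>states M. trans M s a s') = (if a \<in> allowed M s then 1 else 0)) \<and>
     (\<forall>s\<in>states M. 0 \<le> init M s) \<and> (\<Sum>s\<in>states M. init M s) = 1"

definition is_lmdp :: "('s, 'a, 'p) lmdp \<Rightarrow> bool" where
  "is_lmdp M \<longleftrightarrow>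
     is_mdp M \<and> finite (props M) \<and> (\<forall>s\<in>states M. label M s \<subseteq> props M)"

definition state_actions :: "('s, 'a, 'm) mdp_scheme \<Rightarrow> ('s \<times> 'a) set" where
  "state_actions M = (SIGMA s:states M. allowed M s)"

text \<open>
  The prefix \<open>h\<^sub>t = (s\<^sub>0, a\<^sub>0, \<dots>, s\<^sub>t)\<close> is given as the list
  \<open>[(s\<^sub>0, a\<^sub>0), \<dots>, (s\<^sub>t\<^sub>-\<^sub>1, a\<^sub>t\<^sub>-\<^sub>1)]\<close> together with the current state \<open>s\<^sub>t\<close>; the third
  argument is the time step, which is the length of that list whenever the policy is used.
\<close>

type_synonym ('s, 'a) policy = "('s \<times> 'a) list \<Rightarrow> 's \<Rightarrow> nat \<Rightarrow> 'a pmf"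

definition policies :: "('s, 'a, 'm) mdp_scheme \<Rightarrow> ('s, 'a) policy set" where
  "policies M = {\<pi>. \<forall>h\<in>lists (state_actions M). \<forall>s\<in>states M.
     set_pmf (\<pi> h s (length h)) \<subseteq> allowed M s}"

definition stationary :: "('s, 'a, 'm) mdp_scheme \<Rightarrow> ('s, 'a) policy \<Rightarrow> bool" where
  "stationary M \<pi> \<longleftrightarrow>
     (\<exists>f. \<forall>h\<in>lists (state_actions M). \<forall>s\<in>states M. \<pi> h s (length h) = f s)"


section \<open>The trajectory measure of a policy\<close>

text \<open>
  A trajectory is a sequence of state-action pairs.  The kernel gives the distribution of the pair
  \<open>(s\<^sub>i, a\<^sub>i)\<close> given the pairs with indices below \<open>i\<close>; the measure on
  infinite trajectories is the one constructed by the Ionescu-Tulcea theorem.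
\<close>

definition step_kernel ::
  "('s, 'a, 'm) mdp_scheme \<Rightarrow> ('s, 'a) policy \<Rightarrow> nat \<Rightarrow> (nat \<Rightarrow> 's \<times> 'a) \<Rightarrow> ('s \<times> 'a) measure" where
  "step_kernel M \<pi> i \<omega> = point_measure (state_actions M) (\<lambda>(s, a). ennreal
     ((if i = 0 then init M s else trans M (fst (\<omega> (i - 1))) (snd (\<omega> (i - 1))) s) *
      pmf (\<pi> (map \<omega> [0..<i]) s i) a))"

definition traj_measure ::
  "('s, 'a, 'm) mdp_scheme \<Rightarrow> ('s, 'a) policy \<Rightarrow> (nat \<Rightarrow> 's \<times> 'a) measure" where
  "traj_measure M \<pi> = projective_family.lim UNIV
     (Ionescu_Tulcea.CI (step_kernel M \<pi>) (\<lambda>_. count_space (state_actions M)))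
     (\<lambda>_. count_space (state_actions M))"

definition path_prob ::
  "('s, 'a, 'm) mdp_scheme \<Rightarrow> ('s, 'a) policy \<Rightarrow> ((nat \<Rightarrow> 's) \<Rightarrow> bool) \<Rightarrow> real" where
  "path_prob M \<pi> E = \<P>(\<omega> in traj_measure M \<pi>. E (\<lambda>t. fst (\<omega> t)))"

lemma sum_state_actions:
  assumes "is_mdp M"
    and supp: "\<And>s. s \<in> states M \<Longrightarrow> set_pmf (p s) \<subseteq> allowed M s"
  shows "(\<Sum>(s, a)\<in>state_actions M. g s * pmf (p s) a) = (\<Sum>s\<in>states M. g s)"
proof -
  have finA: "finite (allowed M s)" if "s \<in> states M" for s
    using assms(1) that by (auto simp: is_mdp_def intro: finite_subset)
  have fin: "finite (states M)"
    using assms(1) by (simp add: is_mdp_def)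
  have "(\<Sum>(s, a)\<in>state_actions M. g s * pmf (p s) a) =
        (\<Sum>s\<in>states M. \<Sum>a\<in>allowed M s. g s * pmf (p s) a)"
    unfolding state_actions_def using fin finA by (subst sum.Sigma) auto
  also have "\<dots> = (\<Sum>s\<in>states M. g s)"
    using finA supp by (intro sum.cong) (auto simp: sum_distrib_left[symmetric] sum_pmf_eq_1)
  finally show ?thesis .
qed

lemma Ionescu_Tulcea_step_kernel:
  assumes M: "is_mdp M" and \<pi>: "\<pi> \<in> policies M"
  shows "Ionescu_Tulcea (step_kernel M \<pi>) (\<lambda>_. count_space (state_actions M))"
proof -
  have fin: "finite (state_actions M)"
    using M unfolding state_actions_def is_mdp_def
    by (intro finite_SigmaI) (auto intro: finite_subset)
  have space: "space (PiM {0..<i} (\<lambda>_. count_space (state_actions M))) = {0..<i} \<rightarrow>\<^sub>E state_actions M" for i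
    by (simp add: space_PiM)
  have PiM: "PiM {0..<i} (\<lambda>_. count_space (state_actions M)) =
      count_space ({0..<i} \<rightarrow>\<^sub>E state_actions M)" for i :: nat
    using fin by (intro count_space_PiM_finite) (auto intro: countable_finite)
  have prob: "prob_space (step_kernel M \<pi> i \<omega>)" if \<omega>: "\<omega> \<in> {0..<i} \<rightarrow>\<^sub>E state_actions M" for i \<omega>
  proof -
    define g where
      "g s = (if i = 0 then init M s else trans M (fst (\<omega> (i - 1))) (snd (\<omega> (i - 1))) s)" for s
    have prev: "\<omega> (i - 1) \<in> state_actions M" if "i \<noteq> 0"
      using \<omega> that by (auto simp: PiE_iff)
    have g0: "0 \<le> g s" if "s \<in> states M" for s
    proof (cases "i = 0")
      case False
      obtain s' a' where sa: "\<omega> (i - 1) = (s', a')" "s' \<in> states M" "a' \<in> allowed M s'"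
        using prev[OF False] by (auto simp: state_actions_def)
      then have "a' \<in> acts M"
        using M by (auto simp: is_mdp_def)
      then have "trans M s' a' s \<in> {0..1}"
        using M sa(2) that unfolding is_mdp_def by blast
      with False sa(1) show ?thesis
        by (simp add: g_def)
    next
      case True
      with M that show ?thesis by (simp add: g_def is_mdp_def)
    qed
    have g1: "(\<Sum>s\<in>states M. g s) = 1"
    proof (cases "i = 0")
      case False
      obtain s' a' where sa: "\<omega> (i - 1) = (s', a')" "s' \<in> states M" "a' \<in> allowed M s'"
        using prev[OF False] by (auto simp: state_actions_def)
      then have "a' \<in> acts M"
        using M by (auto simp: is_mdp_def)
      then have "(\<Sum>s\<in>states M. trans M s' a' s) = 1"
        using M sa unfolding is_mdp_def by simp
      with False sa(1) show ?thesis
        by (simp add: g_def)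
    next
      case True
      with M show ?thesis by (simp add: g_def is_mdp_def)
    qed
    have h: "map \<omega> [0..<i] \<in> lists (state_actions M)"
      using \<omega> by (auto simp: PiE_iff)
    have supp: "set_pmf (\<pi> (map \<omega> [0..<i]) s i) \<subseteq> allowed M s" if "s \<in> states M" for s
    proof -
      have "set_pmf (\<pi> (map \<omega> [0..<i]) s (length (map \<omega> [0..<i]))) \<subseteq> allowed M s"
        using \<pi> h that unfolding policies_def by blast
      then show ?thesis by simp
    qed
    have "emeasure (step_kernel M \<pi> i \<omega>) (state_actions M) =
        (\<Sum>(s, a)\<in>state_actions M. ennreal (g s * pmf (\<pi> (map \<omega> [0..<i]) s i) a))"
      unfolding step_kernel_def g_def using fin
      by (subst emeasure_point_measure_finite) (auto simp: case_prod_beta)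
    also have "\<dots> = ennreal (\<Sum>(s, a)\<in>state_actions M. g s * pmf (\<pi> (map \<omega> [0..<i]) s i) a)"
      using g0 by (subst sum_ennreal[symmetric]) (auto simp: state_actions_def case_prod_beta)
    also have "\<dots> = 1"
      using sum_state_actions[OF M supp] g1 by simp
    finally show ?thesis
      by (intro prob_spaceI) (simp add: step_kernel_def space_point_measure)
  qed
  have "step_kernel M \<pi> i \<in> PiM {0..<i} (\<lambda>_. count_space (state_actions M))
      \<rightarrow>\<^sub>M subprob_algebra (count_space (state_actions M))" for i
  proof -
    have "sets (step_kernel M \<pi> i \<omega>) = sets (count_space (state_actions M))" for \<omega>
      by (simp add: step_kernel_def sets_point_measure)
    then have "step_kernel M \<pi> i \<in> ({0..<i} \<rightarrow>\<^sub>E state_actions M) \<rightarrow>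
        space (subprob_algebra (count_space (state_actions M)))"
      using prob
      by (auto simp only: space_subprob_algebra Pi_iff mem_Collect_eq intro!: prob_space_imp_subprob_space)
    then show ?thesis
      unfolding PiM by simp
  qed
  with prob show ?thesis
    unfolding Ionescu_Tulcea_def space by blast
qed


section \<open>Linear temporal logic\<close>

datatype 'p ltl =
    LTrue
  | LProp 'p
  | LAnd "'p ltl" "'p ltl"
  | LNot "'p ltl"
  | LNext "'p ltl"
  | LUntil "'p ltl" "'p ltl"

primrec models :: "(nat \<Rightarrow> 'p set) \<Rightarrow> 'p ltl \<Rightarrow> bool" where
  "models w LTrue \<longleftrightarrow> True"
| "models w (LProp p) \<longleftrightarrow> p \<in> w 0"
| "models w (LAnd \<phi> \<psi>) \<longleftrightarrow> models w \<phi> \<and> models w \<psi>"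
| "models w (LNot \<phi>) \<longleftrightarrow> \<not> models w \<phi>"
| "models w (LNext \<phi>) \<longleftrightarrow> models (\<lambda>i. w (Suc i)) \<phi>"
| "models w (LUntil \<phi> \<psi>) \<longleftrightarrow>
     (\<exists>j. models (\<lambda>i. w (j + i)) \<psi> \<and> (\<forall>k<j. models (\<lambda>i. w (k + i)) \<phi>))"

definition co_safe :: "'p set \<Rightarrow> 'p ltl \<Rightarrow> bool" where
  "co_safe P \<phi> \<longleftrightarrow>
     (\<forall>w. range w \<subseteq> Pow P \<longrightarrow> models w \<phi> \<longrightarrow>
        (\<exists>n. \<forall>w'. range w' \<subseteq> Pow P \<longrightarrow> (\<forall>i<n. w' i = w i) \<longrightarrow> models w' \<phi>))"

definition sc_ltl :: "'p set \<Rightarrow> 'p ltl \<Rightarrow> bool" where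
  "sc_ltl P \<phi> \<longleftrightarrow> set_ltl \<phi> \<subseteq> P \<and> co_safe P \<phi>"

definition path_models :: "('s, 'a, 'p) lmdp \<Rightarrow> (nat \<Rightarrow> 's) \<Rightarrow> 'p ltl \<Rightarrow> bool" where
  "path_models M \<sigma> \<phi> \<longleftrightarrow> models (\<lambda>t. label M (\<sigma> t)) \<phi>"


section \<open>Deterministic finite automata\<close>

record ('q, 'l) dfa =
  dstates :: "'q set"
  alphabet :: "'l set"
  delta :: "'q \<Rightarrow> 'l \<Rightarrow> 'q option"
  dinit :: 'q
  final :: "'q set"

definition is_dfa :: "('q, 'l) dfa \<Rightarrow> bool" where
  "is_dfa D \<longleftrightarrow>
     finite (dstates D) \<and> finite (alphabet D) \<and>
     (\<forall>q\<in>dstates D. \<forall>l\<in>alphabet D. set_option (delta D q l) \<subseteq> dstates D) \<and>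
     dinit D \<in> dstates D \<and> final D \<subseteq> dstates D"

primrec run :: "('q, 'l) dfa \<Rightarrow> 'q \<Rightarrow> 'l list \<Rightarrow> 'q option" where
  "run D q [] = Some q"
| "run D q (l # w) = Option.bind (delta D q l) (\<lambda>q'. run D q' w)"

definition accepts :: "('s, 'a, 'p) lmdp \<Rightarrow> ('q, 'p set) dfa \<Rightarrow> (nat \<Rightarrow> 's) \<Rightarrow> bool" where
  "accepts M D \<sigma> \<longleftrightarrow>
     (\<exists>t. \<exists>q\<in>final D. run D (dinit D) (map (\<lambda>i. label M (\<sigma> i)) [0..<Suc t]) = Some q)"

definition represents :: "('s, 'a, 'p) lmdp \<Rightarrow> ('q, 'p set) dfa \<Rightarrow> 'p ltl \<Rightarrow> bool" where
  "represents M D \<phi> \<longleftrightarrow>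
     is_dfa D \<and> alphabet D = Pow (props M) \<and>
     (\<forall>q\<in>final D. \<forall>l\<in>alphabet D. delta D q l = Some q) \<and>
     (\<forall>\<sigma>. range \<sigma> \<subseteq> states M \<longrightarrow> path_models M \<sigma> \<phi> = accepts M D \<sigma>)"


section \<open>The double product\<close>

text \<open>
  A transition function may be undefined at \<open>(q, L s)\<close>.  The corresponding row of the product then
  sums to 0 instead of 1, so that the product is not an MDP in the sense of \<open>is_mdp\<close>.
\<close>

definition double_product ::
  "('s, 'a, 'p) lmdp \<Rightarrow> ('q1, 'p set) dfa \<Rightarrow> ('q2, 'p set) dfa \<Rightarrow> ('s \<times> 'q1 \<times> 'q2, 'a) mdp" where
  "double_product M D1 D2 = \<lparr>
     states = states M \<times> dstates D1 \<times> dstates D2,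
     acts = acts M,
     allowed = (\<lambda>(s, q1, q2). allowed M s),
     trans = (\<lambda>(s, q1, q2) a (s', q1', q2').
       if delta D1 q1 (label M s) = Some q1' \<and> delta D2 q2 (label M s) = Some q2'
       then trans M s a s' else 0),
     init = (\<lambda>(s, q1, q2). if q1 = dinit D1 \<and> q2 = dinit D2 then init M s else 0)\<rparr>"

definition target1 ::
  "('s, 'a, 'p) lmdp \<Rightarrow> ('q1, 'p set) dfa \<Rightarrow> ('q2, 'p set) dfa \<Rightarrow> ('s \<times> 'q1 \<times> 'q2) set" where
  "target1 M D1 D2 = {(s, q1, q2) \<in> states (double_product M D1 D2). q1 \<in> final D1}"

definition target2 ::
  "('s, 'a, 'p) lmdp \<Rightarrow> ('q1, 'p set) dfa \<Rightarrow> ('q2, 'p set) dfa \<Rightarrow> ('s \<times> 'q1 \<times> 'q2) set" where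
  "target2 M D1 D2 = {(s, q1, q2) \<in> states (double_product M D1 D2). q2 \<in> final D2}"

definition reaches :: "(nat \<Rightarrow> 'x) \<Rightarrow> 'x set \<Rightarrow> bool" where
  "reaches \<sigma> Y \<longleftrightarrow> (\<exists>t. \<sigma> t \<in> Y)"


section \<open>The constrained problems\<close>

definition feasible ::
  "('s, 'a, 'm) mdp_scheme \<Rightarrow> ((nat \<Rightarrow> 's) \<Rightarrow> bool) \<Rightarrow> real \<Rightarrow> ('s, 'a) policy \<Rightarrow> bool" where
  "feasible M C \<tau> \<pi> \<longleftrightarrow> \<pi> \<in> policies M \<and> path_prob M \<pi> C \<ge> \<tau>"

text \<open>\<open>\<pi>\<close> attains the maximum of the probability of \<open>E\<close> over all policies
  under which \<open>C\<close> has probability at least \<open>\<tau>\<close>.\<close>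

definition optimal ::
  "('s, 'a, 'm) mdp_scheme \<Rightarrow> ((nat \<Rightarrow> 's) \<Rightarrow> bool) \<Rightarrow> ((nat \<Rightarrow> 's) \<Rightarrow> bool) \<Rightarrow> real \<Rightarrow>
     ('s, 'a) policy \<Rightarrow> bool" where
  "optimal M E C \<tau> \<pi> \<longleftrightarrow>
     feasible M C \<tau> \<pi> \<and> (\<forall>\<pi>'. feasible M C \<tau> \<pi>' \<longrightarrow> path_prob M \<pi>' E \<le> path_prob M \<pi> E)"

definition ltl_optimal ::
  "('s, 'a, 'p) lmdp \<Rightarrow> 'p ltl \<Rightarrow> 'p ltl \<Rightarrow> real \<Rightarrow> ('s, 'a) policy \<Rightarrow> bool" where
  "ltl_optimal M \<phi> \<psi> \<tau> \<pi> \<longleftrightarrow>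
     optimal M (\<lambda>\<sigma>. path_models M \<sigma> \<phi>) (\<lambda>\<sigma>. path_models M \<sigma> \<psi>) \<tau> \<pi>"

definition reach_optimal ::
  "('s, 'a, 'm) mdp_scheme \<Rightarrow> 's set \<Rightarrow> 's set \<Rightarrow> real \<Rightarrow> ('s, 'a) policy \<Rightarrow> bool" where
  "reach_optimal M Y Z \<tau> \<pi> \<longleftrightarrow>
     optimal M (\<lambda>\<sigma>. reaches \<sigma> Y) (\<lambda>\<sigma>. reaches \<sigma> Z) \<tau> \<pi>"


section \<open>Recovering a policy from a policy on the product\<close>

text \<open>
  The product transition reads the label of the state that is left, so at time \<open>t\<close> the automata
  have read the labels of \<open>s\<^sub>0, \<dots>, s\<^sub>t\<^sub>-\<^sub>1\<close>.  When the product is an MDP and the argument is a prefix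
  over the state-action pairs of \<open>M\<close>, the runs are defined and \<open>the\<close> is harmless.
\<close>

definition lift_state ::
  "('s, 'a, 'p) lmdp \<Rightarrow> ('q1, 'p set) dfa \<Rightarrow> ('q2, 'p set) dfa \<Rightarrow>
     ('s \<times> 'a) list \<Rightarrow> 's \<Rightarrow> 's \<times> 'q1 \<times> 'q2" where
  "lift_state M D1 D2 h s =
     (let w = map (\<lambda>(s', a). label M s') h
      in (s, the (run D1 (dinit D1) w), the (run D2 (dinit D2) w)))"

definition lift_prefix ::
  "('s, 'a, 'p) lmdp \<Rightarrow> ('q1, 'p set) dfa \<Rightarrow> ('q2, 'p set) dfa \<Rightarrow>
     ('s \<times> 'a) list \<Rightarrow> (('s \<times> 'q1 \<times> 'q2) \<times> 'a) list" where
  "lift_prefix M D1 D2 h =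
     map (\<lambda>i. (lift_state M D1 D2 (take i h) (fst (h ! i)), snd (h ! i))) [0..<length h]"

definition recovered_policy ::
  "('s, 'a, 'p) lmdp \<Rightarrow> ('q1, 'p set) dfa \<Rightarrow> ('q2, 'p set) dfa \<Rightarrow>
     ('s \<times> 'q1 \<times> 'q2, 'a) policy \<Rightarrow> ('s, 'a) policy" where
  "recovered_policy M D1 D2 \<pi> h s t = \<pi> (lift_prefix M D1 D2 h) (lift_state M D1 D2 h s) t"

end

theory Submission
  imports Defs
begin

text \<open>
  The state of the double product at time \<open>t\<close> is a function of the prefix of the LMDP, so policies of
  the two models correspond to each other with equal probabilities of acceptance and of reaching the
  targets.  It remains to find an optimal stationary policy for constrained reachability of two
  absorbing sets \<open>Y\<close>, \<open>Z\<close> in a finite MDP.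

  With discount \<open>l < 1\<close>, the deterministic rules that are optimal for the weighted objective
  \<open>Y + k Z\<close> are exactly those choosing optimal actions everywhere, hence one can pass
  from one to another by changing one state at a time.  Varying \<open>k\<close>, every policy is dominated
  by a convex combination of two deterministic rules that differ in one state.  There are finitely many
  such pairs, so by compactness this survives the limit \<open>l \<longlonglongrightarrow> 1\<close>.  Finally, a convex
  combination of the values of two rules that differ in one state \<open>t\<close> only is dominated by
  randomizing at \<open>t\<close>, and the maximum over the compact union of these segments is attained.
\<close>

section \<open>Discounted occupation of a finite stochastic kernel\<close>

text \<open>Without discount the exchange of optimal rules fails: at \<open>l = 1\<close> a rule may
  pick an action that preserves the optimal value in every state and still circle forever without
  reaching the target, so the Bellman equation does not determine values. For \<open>l < 1\<close>
  it has one solution, and mixing optimal actions is safe. The way back to \<open>l = 1\<close> uses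
  that the expectation of the indicator of an absorbing set is nondecreasing in time: its normalized
  discounted sum is an Abel mean and tends to the reachability probability. The second obstacle is
  that the value of a rule randomized in one state \<open>t\<close> need not depend continuously on
  the probability. If one action at \<open>t\<close> is a self-loop outside the target, any positive
  weight on the other action already yields the value of the latter. Interior points of a segment
  can then be missed by stationary policies, so the proof aims at dominating the segment, not at
  attaining it. One probability must serve \<open>Y\<close> and \<open>Z\<close> together; this
  works because the balance that fixes it involves expected visits to \<open>t\<close> only and not
  the objective.\<close>

lemma summable_power_bounded:
  fixes x :: "nat \<Rightarrow> real"
  assumes "\<And>n. \<bar>x n\<bar> \<le> B" "0 \<le> l" "l < 1"
  shows "summable (\<lambda>n. l ^ n * x n)"
proof (rule summable_comparison_test')
  show "summable (\<lambda>n. l ^ n * B)"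
    using assms by (intro summable_mult2 summable_geometric) auto
  show "norm (l ^ n * x n) \<le> l ^ n * B" if "n \<ge> 0" for n
    using assms by (auto simp: abs_mult intro!: mult_mono)
qed

text \<open>Dominated convergence in Tannery's form; \<open>a\<close> itself is the majorant because
  the powers of \<open>l\<close> are at most 1.\<close>

lemma tendsto_power_sum_at_left:
  fixes a :: "nat \<Rightarrow> real"
  assumes "\<And>n. 0 \<le> a n" "summable a"
  shows "((\<lambda>l. \<Sum>n. l ^ n * a n) \<longlongrightarrow> (\<Sum>n. a n)) (at_left 1)"
proof -
  have "((\<lambda>l. \<Sum>n. l ^ n * a n) \<longlongrightarrow> (\<Sum>n. 1 ^ n * a n)) (at_left 1)"
  proof (rule tannerys_theorem[THEN conjunct2, THEN conjunct2])
    show "((\<lambda>l. l ^ k * a k) \<longlongrightarrow> 1 ^ k * a k) (at_left 1)" for k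
      by (intro tendsto_intros)
    have "eventually (\<lambda>l::real. 0 < l \<and> l < 1) (at_left 1)"
      by (auto simp: eventually_at_left[of 0 "1::real"] intro: exI[of _ 0])
    then have "eventually (\<lambda>l. \<forall>k. norm (l ^ k * a k) \<le> a k) (at_left 1)"
    proof eventually_elim
      case (elim l)
      then show ?case
        using assms(1) by (auto simp: abs_mult power_le_one intro!: mult_left_le_one_le)
    qed
    then have "eventually (\<lambda>x. (\<lambda>l. \<forall>k. norm (l ^ k * a k) \<le> a k) (snd x)) (at_top \<times>\<^sub>F at_left 1)"
      by (rule eventually_compose_filterlim) (rule filterlim_snd)
    then show "eventually (\<lambda>(k, l). norm (l ^ k * a k) \<le> a k) (at_top \<times>\<^sub>F at_left 1)"
      by eventually_elim auto
  qed (use assms in auto)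
  then show ?thesis by simp
qed

text \<open>Summation by parts replaces the mean by \<open>x 0\<close> plus \<open>l\<close> times
  the power series of the increments. Monotonicity makes the increments nonnegative, and they sum to
  \<open>v - x 0\<close> by telescoping.\<close>

lemma tendsto_abel_mean:
  fixes x :: "nat \<Rightarrow> real"
  assumes "incseq x" "x \<longlonglongrightarrow> v"
  shows "((\<lambda>l. (1 - l) * (\<Sum>n. l ^ n * x n)) \<longlongrightarrow> v) (at_left 1)"
proof -
  obtain B where B: "\<And>n. \<bar>x n\<bar> \<le> B"
    using convergent_imp_Bseq[of x] assms(2) by (auto simp: convergent_def Bseq_def)
  define a where "a n = x (Suc n) - x n" for n
  have a0: "0 \<le> a n" for n
    using assms(1) by (simp add: a_def incseq_SucD)
  have "a sums (v - x 0)"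
    unfolding a_def using assms(2) by (rule telescope_sums)
  then have a: "summable a" "suminf a = v - x 0"
    by (auto simp: sums_iff)
  have eq: "x 0 + l * (\<Sum>n. l ^ n * a n) = (1 - l) * (\<Sum>n. l ^ n * x n)" if "0 < l" "l < 1" for l
  proof -
    have s: "summable (\<lambda>n. l ^ n * x n)" "summable (\<lambda>n. l ^ n * x (Suc n))"
      using that B by (auto intro!: summable_power_bounded)
    have "(\<Sum>n. l ^ n * a n) = (\<Sum>n. l ^ n * x (Suc n)) - (\<Sum>n. l ^ n * x n)"
      unfolding a_def right_diff_distrib using s by (simp add: suminf_diff)
    moreover have "(\<Sum>n. l ^ Suc n * x (Suc n)) = (\<Sum>n. l ^ n * x n) - x 0"
      using suminf_split_head[OF s(1)] by simp
    moreover have "(\<Sum>n. l ^ Suc n * x (Suc n)) = l * (\<Sum>n. l ^ n * x (Suc n))"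
      using suminf_mult[OF s(2), of l] by (simp add: mult.assoc)
    ultimately have "x 0 + l * (\<Sum>n. l ^ n * a n)
        = x 0 + ((\<Sum>n. l ^ n * x n) - x 0) - l * (\<Sum>n. l ^ n * x n)"
      by (simp add: right_diff_distrib)
    then show ?thesis
      by (simp add: left_diff_distrib)
  qed
  have "((\<lambda>l. x 0 + l * (\<Sum>n. l ^ n * a n)) \<longlongrightarrow> x 0 + 1 * suminf a) (at_left 1)"
    by (intro tendsto_intros tendsto_power_sum_at_left a0 a)
  then have "((\<lambda>l. x 0 + l * (\<Sum>n. l ^ n * a n)) \<longlongrightarrow> v) (at_left 1)"
    by (simp add: a)
  moreover have "eventually (\<lambda>l::real. 0 < l \<and> l < 1) (at_left 1)"
    by (auto simp: eventually_at_left[of 0 "1::real"] intro: exI[of _ 0])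
  then have "eventually (\<lambda>l. x 0 + l * (\<Sum>n. l ^ n * a n) = (1 - l) * (\<Sum>n. l ^ n * x n)) (at_left 1)"
    by eventually_elim (use eq in auto)
  ultimately show ?thesis
    by (rule Lim_transform_eventually)
qed

section \<open>Iterates and resolvent of a finite stochastic kernel\<close>

definition kop :: "'s set \<Rightarrow> ('s \<Rightarrow> 's \<Rightarrow> real) \<Rightarrow> ('s \<Rightarrow> real) \<Rightarrow> 's \<Rightarrow> real" where
  "kop S K V s = (\<Sum>s'\<in>S. K s s' * V s')"

text \<open>The resolvent, the inverse of \<open>I - l K\<close> applied to \<open>g\<close>, as a
  Neumann series. For \<open>g = indicator {t}\<close> it is the expected discounted number of
  visits to \<open>t\<close>.\<close>

definition green :: "'s set \<Rightarrow> ('s \<Rightarrow> 's \<Rightarrow> real) \<Rightarrow> real \<Rightarrow> ('s \<Rightarrow> real) \<Rightarrow> 's \<Rightarrow> real" where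
  "green S K l g s = (\<Sum>n. l ^ n * (kop S K ^^ n) g s)"

text \<open>When \<open>g\<close> is the indicator of an absorbing set, iterate \<open>n\<close> is
  the probability of being inside at time \<open>n\<close>, so the limit is the probability of ever
  reaching the set. Convergence comes from \<open>g \<le> kop S K g\<close>, see
  \<open>tendsto_hit_val\<close>.\<close>

definition hit_val :: "'s set \<Rightarrow> ('s \<Rightarrow> 's \<Rightarrow> real) \<Rightarrow> ('s \<Rightarrow> real) \<Rightarrow> 's \<Rightarrow> real" where
  "hit_val S K g s = lim (\<lambda>n. (kop S K ^^ n) g s)"

lemma kop_add: "kop S K (\<lambda>s. V s + W s) s = kop S K V s + kop S K W s"
  by (simp add: kop_def distrib_left sum.distrib)

lemma kop_diff: "kop S K (\<lambda>s. V s - W s) s = kop S K V s - kop S K W s"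
  by (simp add: kop_def right_diff_distrib sum_subtractf)

lemma kop_scale: "kop S K (\<lambda>s. c * V s) s = c * kop S K V s"
  by (simp add: kop_def sum_distrib_left mult.left_commute)

lemma kop_cong:
  assumes "\<And>s'. s' \<in> S \<Longrightarrow> K s s' = K' s s'" "\<And>s'. s' \<in> S \<Longrightarrow> V s' = W s'"
  shows "kop S K V s = kop S K' W s"
  unfolding kop_def using assms by (auto intro!: sum.cong)

lemma funpow_kop_cong:
  assumes "\<And>s s'. s \<in> S \<Longrightarrow> s' \<in> S \<Longrightarrow> K s s' = K' s s'" "s \<in> S"
  shows "(kop S K ^^ n) g s = (kop S K' ^^ n) g s"
  using assms(2) by (induction n arbitrary: s) (auto intro!: kop_cong assms(1))

lemma hit_val_cong:
  assumes "\<And>s s'. s \<in> S \<Longrightarrow> s' \<in> S \<Longrightarrow> K s s' = K' s s'" "s \<in> S"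
  shows "hit_val S K g s = hit_val S K' g s"
  unfolding hit_val_def using funpow_kop_cong[OF assms] by simp

locale stochastic_kernel =
  fixes S :: "'s set" and K :: "'s \<Rightarrow> 's \<Rightarrow> real"
  assumes fin: "finite S"
    and nonneg: "\<And>s s'. s \<in> S \<Longrightarrow> s' \<in> S \<Longrightarrow> 0 \<le> K s s'"
    and row_sum: "\<And>s. s \<in> S \<Longrightarrow> (\<Sum>s'\<in>S. K s s') = 1"
begin

lemma kop_mono:
  assumes "\<And>s'. s' \<in> S \<Longrightarrow> V s' \<le> W s'" "s \<in> S"
  shows "kop S K V s \<le> kop S K W s"
  unfolding kop_def using assms nonneg by (auto intro!: sum_mono mult_left_mono)

lemma kop_const: "s \<in> S \<Longrightarrow> kop S K (\<lambda>_. c) s = c"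
  by (simp add: kop_def row_sum flip: sum_distrib_right)

lemma funpow_kop_mono:
  assumes "\<And>s'. s' \<in> S \<Longrightarrow> V s' \<le> W s'" "s \<in> S"
  shows "(kop S K ^^ n) V s \<le> (kop S K ^^ n) W s"
  using assms(2) by (induction n arbitrary: s) (auto intro!: kop_mono assms(1))

lemma funpow_kop_const: "s \<in> S \<Longrightarrow> (kop S K ^^ n) (\<lambda>_. c) s = c"
proof (induction n arbitrary: s)
  case (Suc n)
  then have "kop S K ((kop S K ^^ n) (\<lambda>_. c)) s = kop S K (\<lambda>_. c) s"
    by (intro kop_cong) auto
  with Suc show ?case by (simp add: kop_const)
qed simp

lemma funpow_kop_bounds:
  assumes "\<And>s. s \<in> S \<Longrightarrow> a \<le> g s" "\<And>s. s \<in> S \<Longrightarrow> g s \<le> b" "s \<in> S"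
  shows "a \<le> (kop S K ^^ n) g s" "(kop S K ^^ n) g s \<le> b"
  using funpow_kop_mono[of "\<lambda>_. a" g s n] funpow_kop_mono[of g "\<lambda>_. b" s n] assms
  by (auto simp: funpow_kop_const)

lemma funpow_kop_abs_le: "\<exists>B. \<forall>n. \<forall>s\<in>S. \<bar>(kop S K ^^ n) g s\<bar> \<le> B"
proof (cases "S = {}")
  case False
  have "-Max ((\<lambda>s. \<bar>g s\<bar>) ` S) \<le> g s" "g s \<le> Max ((\<lambda>s. \<bar>g s\<bar>) ` S)" if "s \<in> S" for s
  proof -
    have "\<bar>g s\<bar> \<le> Max ((\<lambda>s. \<bar>g s\<bar>) ` S)"
      using that fin by (intro Max_ge) auto
    then show "-Max ((\<lambda>s. \<bar>g s\<bar>) ` S) \<le> g s" "g s \<le> Max ((\<lambda>s. \<bar>g s\<bar>) ` S)"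
      by linarith+
  qed
  from funpow_kop_bounds[OF this] show ?thesis
    by (intro exI[of _ "Max ((\<lambda>s. \<bar>g s\<bar>) ` S)"]) (auto simp: abs_le_iff minus_le_iff)
qed auto

lemma summable_green:
  assumes "0 \<le> l" "l < 1" "s \<in> S"
  shows "summable (\<lambda>n. l ^ n * (kop S K ^^ n) g s)"
proof -
  obtain B where "\<And>n. \<bar>(kop S K ^^ n) g s\<bar> \<le> B"
    using funpow_kop_abs_le[of g] assms(3) by blast
  then show ?thesis
    by (rule summable_power_bounded[OF _ assms(1,2)])
qed

lemma green_eq:
  assumes l: "0 \<le> l" "l < 1" and s: "s \<in> S"
  shows "green S K l g s = g s + l * kop S K (green S K l g) s"
proof -
  have "kop S K (green S K l g) s = (\<Sum>s'\<in>S. \<Sum>n. K s s' * (l ^ n * (kop S K ^^ n) g s'))"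
    unfolding kop_def[of S K "green S K l g"] green_def using l
    by (intro sum.cong) (auto intro!: suminf_mult[symmetric] summable_green)
  also have "\<dots> = (\<Sum>n. \<Sum>s'\<in>S. K s s' * (l ^ n * (kop S K ^^ n) g s'))"
    using l by (intro suminf_sum[symmetric] summable_mult summable_green)
  also have "\<dots> = (\<Sum>n. l ^ n * (kop S K ^^ Suc n) g s)"
    by (simp add: kop_def sum_distrib_left mult.left_commute)
  finally have *: "kop S K (green S K l g) s = (\<Sum>n. l ^ n * (kop S K ^^ Suc n) g s)" .
  obtain B where B: "\<And>n. \<bar>(kop S K ^^ n) g s\<bar> \<le> B"
    using funpow_kop_abs_le[of g] s by blast
  have "summable (\<lambda>n. l ^ n * (kop S K ^^ Suc n) g s)"
    by (rule summable_power_bounded[OF B l])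
  from suminf_mult[OF this, of l] have "l * kop S K (green S K l g) s = (\<Sum>n. l ^ Suc n * (kop S K ^^ Suc n) g s)"
    unfolding * by (simp add: mult.assoc)
  with suminf_split_head[OF summable_green[OF l s, of g]] show ?thesis
    by (simp add: green_def)
qed

text \<open>A minimum principle: in a minimizer \<open>t\<close> of \<open>D\<close> the average
  over successors is at least \<open>D t\<close>, hence \<open>(1 - l) * D t\<close> is
  nonnegative.\<close>

lemma discounted_nonneg:
  assumes "0 \<le> l" "l < 1" "\<And>s. s \<in> S \<Longrightarrow> l * kop S K D s \<le> D s" "s \<in> S"
  shows "0 \<le> D s"
proof -
  define t where "t = arg_min_on D S"
  have t: "t \<in> S" "\<And>s. s \<in> S \<Longrightarrow> D t \<le> D s"
    unfolding t_def using fin assms(4) by (auto intro: arg_min_if_finite arg_min_least)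
  have "l * D t \<le> l * kop S K D t"
    using kop_mono[of "\<lambda>_. D t" D t] t assms(1) by (auto simp: kop_const intro!: mult_left_mono)
  also have "\<dots> \<le> D t"
    using assms(3) t(1) .
  finally have "0 \<le> (1 - l) * D t"
    by (simp add: algebra_simps)
  then have "0 \<le> D t"
    using assms(2) by (simp add: zero_le_mult_iff)
  with t(2)[OF assms(4)] show ?thesis by simp
qed

text \<open>The minimum principle applied to \<open>W - V\<close>. This comparison gives uniqueness
  of discounted values, policy improvement and the optimality of Bellman rules.\<close>

lemma discounted_le:
  assumes l: "0 \<le> l" "l < 1"
    and "\<And>s. s \<in> S \<Longrightarrow> V s \<le> g s + l * kop S K V s"
    and "\<And>s. s \<in> S \<Longrightarrow> g s + l * kop S K W s \<le> W s"
    and s: "s \<in> S"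
  shows "V s \<le> W s"
proof -
  have "0 \<le> W s - V s"
  proof (rule discounted_nonneg[OF l _ s])
    fix s assume "s \<in> S"
    then show "l * kop S K (\<lambda>s. W s - V s) s \<le> W s - V s"
      using assms(3,4)[of s] by (simp add: kop_diff algebra_simps)
  qed
  then show ?thesis by simp
qed

text \<open>Later identities for \<open>green\<close> are obtained by exhibiting a solution of its
  fixed-point equation.\<close>

lemma green_unique:
  assumes l: "0 \<le> l" "l < 1"
    and "\<And>s. s \<in> S \<Longrightarrow> V s = g s + l * kop S K V s" and s: "s \<in> S"
  shows "V s = green S K l g s"
  using assms green_eq[OF l]
  by (intro antisym discounted_le[OF l]) (auto simp: order_eq_iff)

lemma green_linear:
  assumes l: "0 \<le> l" "l < 1" and s: "s \<in> S"
  shows "green S K l (\<lambda>s. a * g s + b * h s) s = a * green S K l g s + b * green S K l h s"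
  using green_eq[OF l]
  by (intro green_unique[OF l _ s, symmetric]) (simp add: kop_add kop_scale algebra_simps)

lemma incseq_funpow_kop:
  assumes "\<And>s. s \<in> S \<Longrightarrow> g s \<le> kop S K g s" "s \<in> S"
  shows "incseq (\<lambda>n. (kop S K ^^ n) g s)"
proof (rule incseq_SucI)
  show "(kop S K ^^ n) g s \<le> (kop S K ^^ Suc n) g s" for n
    using funpow_kop_mono[of g "kop S K g" s n] assms by (simp add: funpow_swap1)
qed

lemma tendsto_hit_val:
  assumes "\<And>s. s \<in> S \<Longrightarrow> g s \<le> kop S K g s" "s \<in> S"
  shows "(\<lambda>n. (kop S K ^^ n) g s) \<longlonglongrightarrow> hit_val S K g s"
proof -
  obtain B where B: "\<And>n. \<bar>(kop S K ^^ n) g s\<bar> \<le> B"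
    using funpow_kop_abs_le[of g] assms(2) by blast
  have "Bseq (\<lambda>n. (kop S K ^^ n) g s)"
    using B by (intro BseqI'[of _ B]) simp
  then have "convergent (\<lambda>n. (kop S K ^^ n) g s)"
    using incseq_funpow_kop[of g, OF assms] incseq_imp_monoseq by (intro Bseq_monoseq_convergent) auto
  then show ?thesis
    by (simp add: hit_val_def convergent_LIMSEQ_iff)
qed

lemma tendsto_green:
  assumes "\<And>s. s \<in> S \<Longrightarrow> g s \<le> kop S K g s" "s \<in> S"
  shows "((\<lambda>l. (1 - l) * green S K l g s) \<longlongrightarrow> hit_val S K g s) (at_left 1)"
  unfolding green_def
  by (intro tendsto_abel_mean incseq_funpow_kop tendsto_hit_val assms)

text \<open>A state from which the \<open>g\<close>-value can still grow is visited finitely often in expectation,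
  since every visit is followed within \<open>N\<close> steps by an expected gain of at least \<open>c > 0\<close>.\<close>

lemma summable_visits:
  assumes g: "\<And>s. s \<in> S \<Longrightarrow> 0 \<le> g s" "\<And>s. s \<in> S \<Longrightarrow> g s \<le> 1"
    and sub: "\<And>s. s \<in> S \<Longrightarrow> g s \<le> kop S K g s"
    and t: "t \<in> S" and N: "(kop S K ^^ N) g t \<noteq> g t" and s: "s \<in> S"
  shows "summable (\<lambda>n. (kop S K ^^ n) (indicator {t}) s)"
proof -
  define c where "c = (kop S K ^^ N) g t - g t"
  have grow: "g s \<le> (kop S K ^^ N) g s" if "s \<in> S" for s
    using incseq_funpow_kop[of g, OF sub that] by (auto simp: incseq_def dest: spec[of _ 0])
  then have c: "c > 0"
    using N t by (force simp: c_def)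
  have lin: "(kop S K ^^ n) (\<lambda>s. (kop S K ^^ N) g s - g s) s = (kop S K ^^ (n + N)) g s - (kop S K ^^ n) g s" for n s
  proof (induction n arbitrary: s)
    case (Suc n)
    have "kop S K ((kop S K ^^ n) (\<lambda>s. (kop S K ^^ N) g s - g s)) s
        = kop S K (\<lambda>s. (kop S K ^^ (n + N)) g s - (kop S K ^^ n) g s) s"
      using Suc by (intro kop_cong) auto
    then show ?case by (simp add: kop_diff)
  qed simp
  have scale: "(kop S K ^^ n) (\<lambda>s. c * h s) s = c * (kop S K ^^ n) h s" for n h s
  proof (induction n arbitrary: s)
    case (Suc n)
    have "kop S K ((kop S K ^^ n) (\<lambda>s. c * h s)) s = kop S K (\<lambda>s. c * (kop S K ^^ n) h s) s"
      using Suc by (intro kop_cong) auto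
    then show ?case by (simp add: kop_scale)
  qed simp
  have le: "c * (kop S K ^^ n) (indicator {t}) s \<le> (kop S K ^^ (n + N)) g s - (kop S K ^^ n) g s" for n
  proof -
    have "(kop S K ^^ n) (\<lambda>s. c * indicator {t} s) s \<le> (kop S K ^^ n) (\<lambda>s. (kop S K ^^ N) g s - g s) s"
      using s grow by (intro funpow_kop_mono) (auto simp: c_def indicator_def)
    then show ?thesis
      unfolding lin scale .
  qed
  \<comment> \<open>Summing \<open>N\<close>-step increments over \<open>m\<close> times equals
    summing \<open>m\<close>-step increments over \<open>N\<close> times. The right side has
    \<open>N\<close> terms of size at most 1 when \<open>x\<close> stays between 0 and 1, which
    bounds the visits uniformly in \<open>m\<close>.\<close>
  have tele: "(\<Sum>n<m. x (n + N) - x n) = (\<Sum>n<N. x (n + m) - x n)" for x :: "nat \<Rightarrow> real" and m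
  proof (induction m)
    case (Suc m)
    have "(\<Sum>n<N. x (n + Suc m) - x n) = (\<Sum>n<N. x (n + m) - x n) + (\<Sum>n<N. x (m + Suc n) - x (m + n))"
      by (simp add: sum_subtractf add.commute)
    also have "(\<Sum>n<N. x (m + Suc n) - x (m + n)) = x (m + N) - x m"
      using sum_lessThan_telescope[of "\<lambda>n. x (m + n)" N] by simp
    finally show ?case using Suc by simp
  qed simp
  have sum_le: "c * (\<Sum>n<m. (kop S K ^^ n) (indicator {t}) s) \<le> real N" for m
  proof -
    have "c * (\<Sum>n<m. (kop S K ^^ n) (indicator {t}) s) \<le> (\<Sum>n<m. (kop S K ^^ (n + N)) g s - (kop S K ^^ n) g s)"
      unfolding sum_distrib_left by (intro sum_mono le)
    also have "\<dots> = (\<Sum>n<N. (kop S K ^^ (n + m)) g s - (kop S K ^^ n) g s)"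
      by (rule tele[of "\<lambda>n. (kop S K ^^ n) g s"])
    also have "\<dots> \<le> (\<Sum>n<N. 1)"
    proof (rule sum_mono)
      fix n
      show "(kop S K ^^ (n + m)) g s - (kop S K ^^ n) g s \<le> 1"
        using funpow_kop_bounds(1)[of 0 g 1 s n, OF g s] funpow_kop_bounds(2)[of 0 g 1 s "n + m", OF g s]
        by linarith
    qed
    finally show ?thesis by simp
  qed
  show ?thesis
  proof (rule bounded_imp_summable[of _ "real N / c"])
    show "0 \<le> (kop S K ^^ n) (indicator {t}) s" for n
      by (rule funpow_kop_bounds(1)[of 0 _ 1]) (auto simp: s indicator_def)
    have "c * (\<Sum>i\<le>n. (kop S K ^^ i) (indicator {t}) s) \<le> real N" for n
      using sum_le[of "Suc n"] unfolding lessThan_Suc_atMost .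
    then show "(\<Sum>i\<le>n. (kop S K ^^ i) (indicator {t}) s) \<le> real N / c" for n
      using c by (simp add: pos_le_divide_eq mult.commute)
  qed
qed

end

section \<open>Two kernels that differ in one row\<close>

definition mix_row :: "'s \<Rightarrow> real \<Rightarrow> ('s \<Rightarrow> 's \<Rightarrow> real) \<Rightarrow> ('s \<Rightarrow> 's \<Rightarrow> real) \<Rightarrow> 's \<Rightarrow> 's \<Rightarrow> real" where
  "mix_row t p K K' s s' = (if s = t then p * K s s' + (1 - p) * K' s s' else K s s')"

lemma kop_mix_row:
  "kop S (mix_row t p K K') V s =
    (if s = t then p * kop S K V s + (1 - p) * kop S K' V s else kop S K V s)"
  by (simp add: kop_def mix_row_def distrib_right sum.distrib sum_distrib_left mult.assoc)

locale kernel_pair = K: stochastic_kernel S K + K': stochastic_kernel S K'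
  for S :: "'s set" and K K' +
  fixes t
  assumes t: "t \<in> S"
    and agree: "\<And>s s'. s \<in> S \<Longrightarrow> s' \<in> S \<Longrightarrow> s \<noteq> t \<Longrightarrow> K s s' = K' s s'"
begin

lemma kop_agree: "s \<in> S \<Longrightarrow> s \<noteq> t \<Longrightarrow> kop S K V s = kop S K' V s"
  by (auto intro: kop_cong agree)

lemma stochastic_mix_row:
  assumes "0 \<le> p" "p \<le> 1"
  shows "stochastic_kernel S (mix_row t p K K')"
proof
  show "0 \<le> mix_row t p K K' s s'" if "s \<in> S" "s' \<in> S" for s s'
    using assms that K.nonneg K'.nonneg by (auto simp: mix_row_def)
  show "(\<Sum>s'\<in>S. mix_row t p K K' s s') = 1" if "s \<in> S" for s
    using that t kop_mix_row[of S t p K K' "\<lambda>_. 1" s]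
    by (auto simp: K.row_sum K'.row_sum kop_def split: if_splits)
qed (rule K.fin)

text \<open>The value functions of the two kernels differ by a multiple of the expected number of
  discounted visits to \<open>t\<close>.\<close>

lemma green_shift:
  fixes g
  assumes l: "0 \<le> l" "l < 1" and s: "s \<in> S"
  defines "V \<equiv> green S K l g"
  shows "green S K' l g s =
    V s + (g t + l * kop S K' V t - V t) * green S K' l (indicator {t}) s"
proof -
  \<comment> \<open>\<open>e\<close> is the residual of \<open>V\<close> at \<open>t\<close> in the
    equation of \<open>K'\<close>. Elsewhere the rows agree and the residual vanishes, so adding
    \<open>e\<close> times the resolvent of \<open>indicator {t}\<close> corrects it.\<close>
  define e where "e = g t + l * kop S K' V t - V t"
  let ?G = "green S K' l (indicator {t})"
  have "V s + e * ?G s = green S K' l g s"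
  proof (rule K'.green_unique[OF l _ s])
    fix s assume s: "s \<in> S"
    have kop: "kop S K' (\<lambda>s. V s + e * ?G s) s = kop S K' V s + e * kop S K' ?G s"
      by (simp only: kop_add kop_scale)
    have G: "?G s = indicator {t} s + l * kop S K' ?G s"
      by (rule K'.green_eq[OF l s])
    have V: "V s = g s + l * kop S K V s"
      unfolding V_def by (rule K.green_eq[OF l s])
    show "V s + e * ?G s = g s + l * kop S K' (\<lambda>s. V s + e * ?G s) s"
    proof (cases "s = t")
      case True
      have "V t + e = g t + l * kop S K' V t"
        by (simp add: e_def)
      with G True show ?thesis
        unfolding kop by (simp add: distrib_left mult.left_commute)
    next
      case False
      with V s have "V s = g s + l * kop S K' V s"
        by (simp add: kop_agree)
      with G False show ?thesis
        unfolding kop by (simp add: distrib_left mult.left_commute)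
    qed
  qed
  then show ?thesis by (simp add: e_def)
qed

end

text \<open>The situation is symmetric in the two kernels; \<open>swap\<close> names the facts with
  the kernels exchanged.\<close>

sublocale kernel_pair \<subseteq> swap: kernel_pair S K' K t
  by unfold_locales (auto simp: t agree)

context kernel_pair
begin

text \<open>The combination of \<open>V\<close> and \<open>V'\<close> solves the equation of the
  mixed kernel outside \<open>t\<close>. At \<open>t\<close> the cross residuals \<open>e\<close>
  (of \<open>V\<close> under \<open>K'\<close>) and \<open>e'\<close> (of \<open>V'\<close> under
  \<open>K\<close>) enter with weights \<open>(1 - p) * (1 - \<theta>)\<close> and
  \<open>p * \<theta>\<close>, and the balance hypothesis makes them cancel for every
  \<open>g\<close> at once.\<close>

lemma green_mix_row:
  assumes l: "0 \<le> l" "l < 1" and p: "0 \<le> p" "p \<le> 1"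
    and \<theta>: "p * \<theta> * green S K' l (indicator {t}) t = (1 - p) * (1 - \<theta>) * green S K l (indicator {t}) t"
    and pos: "green S K l (indicator {t}) t > 0"
    and s: "s \<in> S"
  shows "green S (mix_row t p K K') l g s = (1 - \<theta>) * green S K l g s + \<theta> * green S K' l g s"
proof -
  interpret mix: stochastic_kernel S "mix_row t p K K'"
    by (rule stochastic_mix_row[OF p])
  define \<gamma> \<gamma>' where "\<gamma> = green S K l (indicator {t}) t" and "\<gamma>' = green S K' l (indicator {t}) t"
  define V V' where "V = green S K l g" and "V' = green S K' l g"
  define e e' where "e = g t + l * kop S K' V t - V t" and "e' = g t + l * kop S K V' t - V' t"
  \<comment> \<open>The shift identity at \<open>t\<close> gives
    \<open>V' t - V t = e * \<gamma>'\<close> and, with the kernels exchanged,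
    \<open>V t - V' t = e' * \<gamma>\<close>.\<close>
  have "e * \<gamma>' + e' * \<gamma> = 0"
    using green_shift[OF l t, of g] swap.green_shift[OF l t, of g]
    by (simp add: V_def V'_def e_def e'_def \<gamma>_def \<gamma>'_def)
  then have "\<gamma> * (p * \<theta> * e' + (1 - p) * (1 - \<theta>) * e) = e * ((1 - p) * (1 - \<theta>) * \<gamma> - p * \<theta> * \<gamma>')"
    by algebra
  also have "\<dots> = 0"
    using \<theta> by (simp add: \<gamma>_def \<gamma>'_def)
  finally have bal: "p * \<theta> * e' + (1 - p) * (1 - \<theta>) * e = 0"
    using pos by (simp add: \<gamma>_def)
  let ?U = "\<lambda>s. (1 - \<theta>) * V s + \<theta> * V' s"
  have "?U s = green S (mix_row t p K K') l g s"
  proof (rule mix.green_unique[OF l _ s])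
    fix s assume s: "s \<in> S"
    have eqs: "V s = g s + l * kop S K V s" "V' s = g s + l * kop S K' V' s"
      unfolding V_def V'_def using K.green_eq[OF l s] K'.green_eq[OF l s] by auto
    show "?U s = g s + l * kop S (mix_row t p K K') ?U s"
    proof (cases "s = t")
      case True
      \<comment> \<open>The residual split by kernel and value: the two matching terms vanish by
        \<open>eqs\<close>, the two cross terms by \<open>bal\<close>.\<close>
      have "g t + l * kop S (mix_row t p K K') ?U t - ?U t =
          p * \<theta> * e' + (1 - p) * (1 - \<theta>) * e
          + p * (1 - \<theta>) * (g t + l * kop S K V t - V t)
          + (1 - p) * \<theta> * (g t + l * kop S K' V' t - V' t)"
        by (simp add: kop_mix_row kop_add kop_scale e_def e'_def) algebra
      then show ?thesis
        using eqs True bal by simp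
    next
      case False
      then have kop: "kop S (mix_row t p K K') ?U s = (1 - \<theta>) * kop S K V s + \<theta> * kop S K' V' s"
        using s by (simp add: kop_mix_row kop_add kop_scale kop_agree)
      have "g s + l * kop S (mix_row t p K K') ?U s
          = (1 - \<theta>) * (g s + l * kop S K V s) + \<theta> * (g s + l * kop S K' V' s)"
        unfolding kop by (simp add: algebra_simps)
      with eqs show ?thesis
        by simp
    qed
  qed
  then show ?thesis by (simp add: V_def V'_def)
qed

text \<open>If \<open>g\<close> never grows from \<open>t\<close> under \<open>K\<close>, then
  \<open>t\<close> is worth exactly \<open>g t\<close> at all times, and \<open>K'\<close> does at
  least as well there since its iterates increase from \<open>g t\<close>. Off \<open>t\<close> the
  rows coincide, so induction on the time compares all iterates.\<close>

lemma hit_val_le_if_stuck: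
  assumes "\<And>s. s \<in> S \<Longrightarrow> g s \<le> kop S K g s" "\<And>s. s \<in> S \<Longrightarrow> g s \<le> kop S K' g s"
    and stuck: "\<And>n. (kop S K ^^ n) g t = g t" and s: "s \<in> S"
  shows "hit_val S K g s \<le> hit_val S K' g s"
proof (rule LIMSEQ_le[OF K.tendsto_hit_val[of g] K'.tendsto_hit_val[of g]])
  have "(kop S K ^^ n) g s \<le> (kop S K' ^^ n) g s" for n
    using s
  proof (induction n arbitrary: s)
    case (Suc n)
    show ?case
    proof (cases "s = t")
      case True
      have "g t \<le> (kop S K' ^^ Suc n) g t"
        using incseqD[OF K'.incseq_funpow_kop[of g, OF assms(2) t], of 0 "Suc n"] by simp
      with stuck[of "Suc n"] True show ?thesis by simp
    next
      case False
      then have "(kop S K ^^ Suc n) g s = kop S K' ((kop S K ^^ n) g) s"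
        using Suc.prems by (simp add: kop_agree)
      also have "\<dots> \<le> (kop S K' ^^ Suc n) g s"
        using Suc by (auto intro: K'.kop_mono)
      finally show ?thesis .
    qed
  qed simp
  then show "\<exists>N. \<forall>n\<ge>N. (kop S K ^^ n) g s \<le> (kop S K' ^^ n) g s"
    by blast
qed (use assms in auto)

text \<open>The limit is the expected total number of visits to \<open>t\<close> from
  \<open>t\<close>: finite by \<open>summable_visits\<close> and positive because time 0
  counts.\<close>

lemma tendsto_discounted_visits:
  assumes g: "\<And>s. s \<in> S \<Longrightarrow> 0 \<le> g s" "\<And>s. s \<in> S \<Longrightarrow> g s \<le> 1"
    and sub: "\<And>s. s \<in> S \<Longrightarrow> g s \<le> kop S K g s"
    and N: "(kop S K ^^ N) g t \<noteq> g t"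
  obtains \<Gamma> where "\<Gamma> > 0" "((\<lambda>l. green S K l (indicator {t}) t) \<longlongrightarrow> \<Gamma>) (at_left 1)"
proof
  let ?a = "\<lambda>n. (kop S K ^^ n) (indicator {t}) t :: real"
  have nn: "0 \<le> ?a n" for n
    by (rule K.funpow_kop_bounds(1)[of 0 _ 1]) (auto simp: t indicator_def)
  have sm: "summable ?a"
    by (rule K.summable_visits[of g, OF g sub t N t])
  show "((\<lambda>l. green S K l (indicator {t}) t) \<longlongrightarrow> suminf ?a) (at_left 1)"
    unfolding green_def by (rule tendsto_power_sum_at_left[OF nn sm])
  show "suminf ?a > 0"
    using sum_le_suminf[OF sm, of "{0}"] nn by simp
qed

end

context kernel_pair
begin

text \<open>\<open>G\<close> collects the objectives that one \<open>p\<close> has to serve. If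
  \<open>t\<close> is stuck for all of them under one kernel, the other kernel alone is at least as
  good, and the extreme \<open>p\<close> that selects it dominates the segment. Otherwise both visit
  counts have finite positive limits and a balanced \<open>p\<close> gives equality.\<close>

lemma hit_val_mix_row:
  assumes g: "\<And>g s. g \<in> G \<Longrightarrow> s \<in> S \<Longrightarrow> 0 \<le> g s" "\<And>g s. g \<in> G \<Longrightarrow> s \<in> S \<Longrightarrow> g s \<le> 1"
    and sub: "\<And>g s. g \<in> G \<Longrightarrow> s \<in> S \<Longrightarrow> g s \<le> kop S K g s"
    and sub': "\<And>g s. g \<in> G \<Longrightarrow> s \<in> S \<Longrightarrow> g s \<le> kop S K' g s"
    and \<theta>: "0 \<le> \<theta>" "\<theta> \<le> 1"
  obtains p where "0 \<le> p" "p \<le> 1"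
    "\<And>g s. g \<in> G \<Longrightarrow> s \<in> S \<Longrightarrow>
      (1 - \<theta>) * hit_val S K g s + \<theta> * hit_val S K' g s \<le> hit_val S (mix_row t p K K') g s"
proof -
  have conv: "(1 - \<theta>) * x + \<theta> * y \<le> max x y" for x y :: real
    using convex_bound_le[of x "max x y" y "1 - \<theta>" \<theta>] \<theta> by simp
  \<comment> \<open>In the last case the witnesses \<open>g\<close> and \<open>g'\<close> may
    differ: finiteness of the visits to \<open>t\<close> concerns the kernel alone, so one growing
    objective per kernel suffices.\<close>
  consider (stuck) "\<forall>g\<in>G. \<forall>n. (kop S K ^^ n) g t = g t"
    | (stuck') "\<forall>g\<in>G. \<forall>n. (kop S K' ^^ n) g t = g t"
    | (trans) g N g' N' where "g \<in> G" "(kop S K ^^ N) g t \<noteq> g t" "g' \<in> G" "(kop S K' ^^ N') g' t \<noteq> g' t"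
    by blast
  then show ?thesis
  proof cases
    case stuck
    have eq: "hit_val S (mix_row t 0 K K') g s = hit_val S K' g s" if "s \<in> S" for g s
      using that by (intro hit_val_cong) (auto simp: mix_row_def agree)
    have "hit_val S K g s \<le> hit_val S K' g s" if "g \<in> G" "s \<in> S" for g s
      using that stuck by (intro hit_val_le_if_stuck sub sub') auto
    with conv show ?thesis
      by (intro that[of 0]) (auto simp: eq max_def intro: order_trans[OF conv])
  next
    case stuck'
    have eq: "hit_val S (mix_row t 1 K K') g s = hit_val S K g s" if "s \<in> S" for g s
      using that by (intro hit_val_cong) (auto simp: mix_row_def agree)
    have "hit_val S K' g s \<le> hit_val S K g s" if "g \<in> G" "s \<in> S" for g s
      using that stuck' by (intro swap.hit_val_le_if_stuck sub sub') auto
    with conv show ?thesis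
      by (intro that[of 1]) (auto simp: eq max_def intro: order_trans[OF conv])
  next
    case trans
    obtain \<Gamma> where \<Gamma>: "\<Gamma> > 0" "((\<lambda>l. green S K l (indicator {t}) t) \<longlongrightarrow> \<Gamma>) (at_left 1)"
      using tendsto_discounted_visits[of g N] trans g sub by metis
    obtain \<Gamma>' where \<Gamma>': "\<Gamma>' > 0" "((\<lambda>l. green S K' l (indicator {t}) t) \<longlongrightarrow> \<Gamma>') (at_left 1)"
      using swap.tendsto_discounted_visits[of g' N'] trans g sub' by metis
    define d where "d = \<theta> * \<Gamma>' + (1 - \<theta>) * \<Gamma>"
    have den: "d > 0"
      unfolding d_def using \<theta> \<Gamma>(1) \<Gamma>'(1) by (cases "\<theta> = 0") (auto intro: add_pos_nonneg)
    \<comment> \<open>Solves \<open>p * \<theta> * \<Gamma>' = (1 - p) * (1 - \<theta>) *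
      \<Gamma>\<close>, the balance of \<open>green_mix_row\<close> in the limit.\<close>
    define p where "p = (1 - \<theta>) * \<Gamma> / d"
    have p: "0 \<le> p" "p \<le> 1"
      unfolding p_def using \<theta> \<Gamma>(1) \<Gamma>'(1) den by (auto simp: divide_simps d_def)
    have q: "1 - p = \<theta> * \<Gamma>' / d"
      unfolding p_def using den by (simp add: diff_divide_eq_iff d_def)
    interpret mix: stochastic_kernel S "mix_row t p K K'"
      by (rule stochastic_mix_row[OF p])
    let ?\<gamma> = "\<lambda>l. green S K l (indicator {t}) t" and ?\<gamma>' = "\<lambda>l. green S K' l (indicator {t}) t"
    \<comment> \<open>With \<open>p\<close> fixed, balance at discount \<open>l\<close> holds for
      the weight \<open>\<eta> l\<close> in place of \<theta>; it tends to \<theta>, so the identity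
      of \<open>green_mix_row\<close> survives the limit.\<close>
    define \<eta> where "\<eta> l = (1 - p) * ?\<gamma> l / (p * ?\<gamma>' l + (1 - p) * ?\<gamma> l)" for l
    have den': "p * \<Gamma>' + (1 - p) * \<Gamma> = \<Gamma> * \<Gamma>' / d"
    proof -
      have "p * \<Gamma>' + (1 - p) * \<Gamma> = ((1 - \<theta>) * \<Gamma> * \<Gamma>' + \<theta> * \<Gamma>' * \<Gamma>) / d"
        unfolding q unfolding p_def by (simp add: add_divide_distrib)
      also have "(1 - \<theta>) * \<Gamma> * \<Gamma>' + \<theta> * \<Gamma>' * \<Gamma> = \<Gamma> * \<Gamma>'"
        by (simp add: algebra_simps)
      finally show ?thesis .
    qed
    have pos: "p * \<Gamma>' + (1 - p) * \<Gamma> > 0"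
      unfolding den' using den \<Gamma>(1) \<Gamma>'(1) by simp
    have "(\<eta> \<longlongrightarrow> (1 - p) * \<Gamma> / (p * \<Gamma>' + (1 - p) * \<Gamma>)) (at_left 1)"
      unfolding \<eta>_def using pos by (intro tendsto_intros \<Gamma> \<Gamma>') auto
    also have "(1 - p) * \<Gamma> / (p * \<Gamma>' + (1 - p) * \<Gamma>) = \<theta>"
      by (subst den', subst q) (use den \<Gamma>(1) \<Gamma>'(1) in simp)
    finally have \<eta>: "(\<eta> \<longlongrightarrow> \<theta>) (at_left 1)" .
    have ev: "eventually (\<lambda>l::real. 0 < l \<and> l < 1) (at_left 1)"
      by (auto simp: eventually_at_left[of 0 "1::real"] intro: exI[of _ 0])
    have ev1: "eventually (\<lambda>l. ?\<gamma> l > 0) (at_left 1)"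
      using order_tendstoD(1)[OF \<Gamma>(2,1)] .
    have "((\<lambda>l. p * ?\<gamma>' l + (1 - p) * ?\<gamma> l) \<longlongrightarrow> p * \<Gamma>' + (1 - p) * \<Gamma>) (at_left 1)"
      by (intro tendsto_intros \<Gamma> \<Gamma>')
    from order_tendstoD(1)[OF this pos]
    have ev2: "eventually (\<lambda>l. p * ?\<gamma>' l + (1 - p) * ?\<gamma> l > 0) (at_left 1)" .
    have "hit_val S (mix_row t p K K') h s = (1 - \<theta>) * hit_val S K h s + \<theta> * hit_val S K' h s"
      if h: "h \<in> G" and s: "s \<in> S" for h s
    proof (rule tendsto_unique[of "at_left (1::real)"])
      have "h s \<le> kop S (mix_row t p K K') h s" if s: "s \<in> S" for s
      proof (cases "s = t")
        case True
        have "(1 - p) * h s + p * h s \<le> (1 - p) * kop S K' h s + p * kop S K h s"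
          using p sub[OF h s] sub'[OF h s] by (intro add_mono mult_left_mono) auto
        with True show ?thesis
          by (simp add: kop_mix_row algebra_simps)
      qed (use s sub[OF h] in \<open>simp add: kop_mix_row\<close>)
      from mix.tendsto_green[of h, OF this s]
      show "((\<lambda>l. (1 - l) * green S (mix_row t p K K') l h s) \<longlongrightarrow>
          hit_val S (mix_row t p K K') h s) (at_left 1)" .
      have "((\<lambda>l. (1 - \<eta> l) * ((1 - l) * green S K l h s) + \<eta> l * ((1 - l) * green S K' l h s)) \<longlongrightarrow>
          (1 - \<theta>) * hit_val S K h s + \<theta> * hit_val S K' h s) (at_left 1)"
        using h s by (intro tendsto_intros \<eta> K.tendsto_green K'.tendsto_green sub sub')
      moreover have "eventually (\<lambda>l. (1 - \<eta> l) * ((1 - l) * green S K l h s) + \<eta> l * ((1 - l) * green S K' l h s)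
          = (1 - l) * green S (mix_row t p K K') l h s) (at_left 1)"
        using ev ev1 ev2
      proof eventually_elim
        case (elim l)
        have "1 - \<eta> l = p * ?\<gamma>' l / (p * ?\<gamma>' l + (1 - p) * ?\<gamma> l)"
          unfolding \<eta>_def using elim by (simp add: field_simps)
        then have "p * \<eta> l * ?\<gamma>' l = (1 - p) * (1 - \<eta> l) * ?\<gamma> l"
          by (simp add: \<eta>_def)
        then have "green S (mix_row t p K K') l h s = (1 - \<eta> l) * green S K l h s + \<eta> l * green S K' l h s"
          using elim by (intro green_mix_row p s) auto
        then show ?case
          by (simp only: distrib_left mult.left_commute)
      qed
      ultimately show "((\<lambda>l. (1 - l) * green S (mix_row t p K K') l h s) \<longlongrightarrow>
          (1 - \<theta>) * hit_val S K h s + \<theta> * hit_val S K' h s) (at_left 1)"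
        by (rule Lim_transform_eventually)
    qed simp
    with p show ?thesis
      by (intro that[of p]) auto
  qed
qed

end

section \<open>Finite prefixes of trajectories\<close>

definition step_prob :: "('s, 'a, 'm) mdp_scheme \<Rightarrow> ('s, 'a) policy \<Rightarrow> ('s \<times> 'a) list \<Rightarrow> 's \<times> 'a \<Rightarrow> real" where
  "step_prob M \<pi> h x =
    (if h = [] then init M (fst x) else trans M (fst (last h)) (snd (last h)) (fst x)) *
      pmf (\<pi> h (fst x) (length h)) (snd x)"

definition prefix_prob :: "('s, 'a, 'm) mdp_scheme \<Rightarrow> ('s, 'a) policy \<Rightarrow> ('s \<times> 'a) list \<Rightarrow> real" where
  "prefix_prob M \<pi> h = (\<Prod>i<length h. step_prob M \<pi> (take i h) (h ! i))"

definition prefixes :: "('s, 'a, 'm) mdp_scheme \<Rightarrow> nat \<Rightarrow> ('s \<times> 'a) list set" where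
  "prefixes M n = {h \<in> lists (state_actions M). length h = n}"

lemma prefix_prob_Nil [simp]: "prefix_prob M \<pi> [] = 1"
  by (simp add: prefix_prob_def)

lemma prefix_prob_snoc: "prefix_prob M \<pi> (h @ [x]) = prefix_prob M \<pi> h * step_prob M \<pi> h x"
  by (simp add: prefix_prob_def nth_append)

lemma policies_supp:
  "\<pi> \<in> policies M \<Longrightarrow> h \<in> lists (state_actions M) \<Longrightarrow> s \<in> states M \<Longrightarrow>
    set_pmf (\<pi> h s (length h)) \<subseteq> allowed M s"
  by (simp add: policies_def)

lemma finite_state_actions: "is_mdp M \<Longrightarrow> finite (state_actions M)"
  unfolding state_actions_def is_mdp_def by (intro finite_SigmaI) (auto intro: finite_subset)

lemma finite_prefixes: "is_mdp M \<Longrightarrow> finite (prefixes M n)"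
  using finite_lists_length_eq[OF finite_state_actions, of M n] by (simp add: prefixes_def lists_eq_set)

lemma sum_prefixes_Suc:
  "(\<Sum>h\<in>prefixes M (Suc n). f h) = (\<Sum>h\<in>prefixes M n. \<Sum>x\<in>state_actions M. f (h @ [x]))"
proof -
  have "bij_betw (\<lambda>(h, x). h @ [x]) (prefixes M n \<times> state_actions M) (prefixes M (Suc n))"
    unfolding bij_betw_def
  proof (intro conjI equalityI subsetI)
    fix k assume k: "k \<in> prefixes M (Suc n)"
    then obtain h x where "k = h @ [x]"
      by (auto simp: prefixes_def length_Suc_conv_rev)
    with k show "k \<in> (\<lambda>(h, x). h @ [x]) ` (prefixes M n \<times> state_actions M)"
      by (auto simp: prefixes_def image_iff)
  qed (auto simp: inj_on_def prefixes_def)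
  from sum.reindex_bij_betw[OF this, of f] show ?thesis
    by (simp add: sum.cartesian_product case_prod_beta)
qed

lemma trans_nonneg:
  assumes "is_mdp M" "s \<in> states M" "a \<in> allowed M s" "s' \<in> states M"
  shows "0 \<le> trans M s a s'"
proof -
  have "a \<in> acts M"
    using assms by (auto simp: is_mdp_def)
  with assms show ?thesis
    unfolding is_mdp_def by (metis atLeastAtMost_iff)
qed

lemma trans_sum:
  assumes "is_mdp M" "s \<in> states M" "a \<in> allowed M s"
  shows "(\<Sum>s'\<in>states M. trans M s a s') = 1"
proof -
  have "a \<in> acts M"
    using assms by (auto simp: is_mdp_def)
  with assms show ?thesis
    unfolding is_mdp_def by simp
qed

lemma step_prob_nonneg:
  assumes M: "is_mdp M" and h: "h \<in> lists (state_actions M)" and x: "x \<in> state_actions M"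
  shows "0 \<le> step_prob M \<pi> h x"
proof -
  have "h \<noteq> [] \<Longrightarrow> last h \<in> state_actions M"
    using h last_in_set by blast
  then show ?thesis
    using M x trans_nonneg[OF M] by (auto simp: step_prob_def state_actions_def is_mdp_def)
qed

lemma prefix_prob_nonneg:
  assumes M: "is_mdp M" and h: "h \<in> lists (state_actions M)"
  shows "0 \<le> prefix_prob M \<pi> h"
  using h by (induction h rule: rev_induct) (auto simp: prefix_prob_snoc intro!: mult_nonneg_nonneg step_prob_nonneg[OF M])

section \<open>The trajectory measure on finite prefixes\<close>

locale mdp_policy =
  fixes M :: "('s, 'a, 'm) mdp_scheme" and \<pi>
  assumes M: "is_mdp M" and \<pi>: "\<pi> \<in> policies M"
begin

sublocale IT: Ionescu_Tulcea "step_kernel M \<pi>" "\<lambda>_. count_space (state_actions M)"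
  by (rule Ionescu_Tulcea_step_kernel[OF M \<pi>])

lemma traj_measure_eq: "traj_measure M \<pi> = IT.PF.lim"
  by (simp add: traj_measure_def)

sublocale traj: prob_space "traj_measure M \<pi>"
proof (rule prob_spaceI)
  interpret CI: prob_space "IT.CI {}"
    by (rule IT.PF.prob_space_P) auto
  let ?X = "space (PiM {} (\<lambda>_. count_space (state_actions M)))"
  have sp: "space (IT.CI {}) = ?X"
    by (simp add: IT.CI_def)
  have "IT.PF.emb UNIV {} ?X = space IT.PF.lim"
    by (auto simp: prod_emb_def space_PiM)
  moreover have "emeasure IT.PF.lim (IT.PF.emb UNIV {} ?X) = emeasure (IT.CI {}) ?X"
    by (intro IT.lim) auto
  ultimately show "emeasure (traj_measure M \<pi>) (space (traj_measure M \<pi>)) = 1"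
    using CI.emeasure_space_1 sp by (simp add: traj_measure_eq)
qed

lemma space_traj: "space (traj_measure M \<pi>) = UNIV \<rightarrow>\<^sub>E state_actions M"
  by (simp add: traj_measure_eq IT.PF.space_lim space_PiM)

lemma sets_traj: "sets (traj_measure M \<pi>) = sets (PiM UNIV (\<lambda>_. count_space (state_actions M)))"
  by (simp add: traj_measure_eq)

lemma PiM_prefix:
  "PiM {0..<n} (\<lambda>_. count_space (state_actions M)) = count_space ({0..<n} \<rightarrow>\<^sub>E state_actions M)" for n :: nat
  using finite_state_actions[OF M] by (intro count_space_PiM_finite) (auto intro: countable_finite)

text \<open>There are finitely many state-action pairs, so the space of prefixes of length
  \<open>n\<close> is discrete and the measure after \<open>n\<close> steps of the Ionescu-Tulcea
  construction is known from its point masses.\<close>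

lemma emeasure_C_prefix:
  assumes "\<omega> \<in> {0..<n} \<rightarrow>\<^sub>E state_actions M"
  shows "emeasure (IT.C 0 n (\<lambda>_. undefined)) {\<omega>} = ennreal (prefix_prob M \<pi> (map \<omega> [0..<n]))"
  using assms
proof (induction n arbitrary: \<omega>)
  case 0
  then show ?case
    by (simp add: PiM_prefix[of 0, simplified])
next
  case (Suc n)
  define \<omega>' where "\<omega>' = restrict \<omega> {0..<n}"
  have \<omega>': "\<omega>' \<in> {0..<n} \<rightarrow>\<^sub>E state_actions M"
    using Suc.prems by (auto simp: \<omega>'_def)
  have un: "(\<lambda>_. undefined) \<in> space (PiM {0..<0::nat} (\<lambda>_. count_space (state_actions M)))"
    by (simp add: space_PiM)
  have map\<omega>': "map \<omega>' [0..<n] = map \<omega> [0..<n]"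
    by (simp add: \<omega>'_def)
  have step: "emeasure (IT.eP n y) {\<omega>} =
      ennreal (step_prob M \<pi> (map \<omega> [0..<n]) (\<omega> n)) * indicator {\<omega>'} y"
    if y: "y \<in> {0..<n} \<rightarrow>\<^sub>E state_actions M" for y
  proof -
    have "emeasure (IT.eP n y) {\<omega>} =
        emeasure (step_kernel M \<pi> n y) ((\<lambda>x. y(n := x)) -` {\<omega>} \<inter> state_actions M)"
      using y Suc.prems by (subst IT.emeasure_eP) (auto simp: PiM_prefix)
    \<comment> \<open>Only one \<open>y\<close> extends to \<omega>, its restriction to the first
      \<open>n\<close> positions; the integral over \<open>y\<close> therefore collapses to one
      point mass.\<close>
    also have "(\<lambda>x. y(n := x)) -` {\<omega>} \<inter> state_actions M = (if y = \<omega>' then {\<omega> n} else {})"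
    proof -
      have "y(n := x) = \<omega> \<longleftrightarrow> y = \<omega>' \<and> x = \<omega> n" for x
      proof
        assume eq: "y(n := x) = \<omega>"
        have "y i = \<omega>' i" for i
          using y eq by (auto simp: \<omega>'_def PiE_iff extensional_def)
        with eq show "y = \<omega>' \<and> x = \<omega> n"
          by auto
      next
        assume "y = \<omega>' \<and> x = \<omega> n"
        then show "y(n := x) = \<omega>"
          using Suc.prems by (auto simp: \<omega>'_def PiE_iff extensional_def fun_eq_iff)
      qed
      then show ?thesis
        using Suc.prems by (auto simp: PiE_iff)
    qed
    also have "emeasure (step_kernel M \<pi> n y) (if y = \<omega>' then {\<omega> n} else {}) =
        ennreal (step_prob M \<pi> (map \<omega> [0..<n]) (\<omega> n)) * indicator {\<omega>'} y"
    proof (cases "y = \<omega>'")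
      case True
      have "\<omega> n \<in> state_actions M"
        using Suc.prems by (auto simp: PiE_iff)
      then have "emeasure (step_kernel M \<pi> n \<omega>') {\<omega> n} =
          ennreal ((if n = 0 then init M (fst (\<omega> n)) else trans M (fst (\<omega>' (n - 1))) (snd (\<omega>' (n - 1))) (fst (\<omega> n))) *
            pmf (\<pi> (map \<omega>' [0..<n]) (fst (\<omega> n)) n) (snd (\<omega> n)))"
        unfolding step_kernel_def using finite_state_actions[OF M]
        by (subst emeasure_point_measure_finite) (auto simp: case_prod_beta)
      moreover have "n \<noteq> 0 \<Longrightarrow> last (map \<omega> [0..<n]) = \<omega>' (n - 1)"
        by (simp add: last_map \<omega>'_def)
      ultimately show ?thesis
        using True by (simp add: step_prob_def map\<omega>')
    qed simp
    finally show ?thesis .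
  qed
  have "emeasure (IT.C 0 (Suc n) (\<lambda>_. undefined)) {\<omega>} =
      (\<integral>\<^sup>+y. emeasure (IT.eP n y) {\<omega>} \<partial>IT.C 0 n (\<lambda>_. undefined))"
  proof -
    have "space (IT.C 0 n (\<lambda>_. undefined)) \<noteq> {}"
      using \<omega>' IT.space_C[OF un, of n] by (auto simp: PiM_prefix)
    moreover have "IT.eP n \<in> IT.C 0 n (\<lambda>_. undefined) \<rightarrow>\<^sub>M
        subprob_algebra (PiM {0..<Suc n} (\<lambda>_. count_space (state_actions M)))"
      using IT.measurable_eP[of n] IT.sets_C[OF un, of n] by (simp cong: measurable_cong_sets)
    moreover have "{\<omega>} \<in> sets (PiM {0..<Suc n} (\<lambda>_. count_space (state_actions M)))"
      using Suc.prems unfolding PiM_prefix by simp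
    ultimately show ?thesis
      unfolding IT.C.simps add_0 by (rule emeasure_bind)
  qed
  also have "\<dots> = (\<integral>\<^sup>+y. ennreal (step_prob M \<pi> (map \<omega> [0..<n]) (\<omega> n)) * indicator {\<omega>'} y \<partial>IT.C 0 n (\<lambda>_. undefined))"
    using IT.space_C[OF un, of n] by (intro nn_integral_cong step) (simp add: PiM_prefix)
  also have "\<dots> = ennreal (step_prob M \<pi> (map \<omega> [0..<n]) (\<omega> n)) * emeasure (IT.C 0 n (\<lambda>_. undefined)) {\<omega>'}"
    using \<omega>' IT.sets_C[OF un, of n] by (subst nn_integral_cmult_indicator) (auto simp: PiM_prefix)
  also have "emeasure (IT.C 0 n (\<lambda>_. undefined)) {\<omega>'} = ennreal (prefix_prob M \<pi> (map \<omega> [0..<n]))"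
    using Suc.IH[OF \<omega>'] by (simp add: map\<omega>')
  also have "ennreal (step_prob M \<pi> (map \<omega> [0..<n]) (\<omega> n)) * \<dots> =
      ennreal (prefix_prob M \<pi> (map \<omega> [0..<Suc n]))"
    using Suc.prems
    by (subst ennreal_mult''[symmetric])
      (auto simp: prefix_prob_snoc mult.commute PiE_iff intro!: prefix_prob_nonneg[OF M])
  finally show ?case .
qed

lemma prefix_event:
  assumes "h \<in> prefixes M n"
  shows "{\<omega> \<in> space (traj_measure M \<pi>). map \<omega> [0..<n] = h} \<in> sets (traj_measure M \<pi>)"
    and "measure (traj_measure M \<pi>) {\<omega> \<in> space (traj_measure M \<pi>). map \<omega> [0..<n] = h} = prefix_prob M \<pi> h"
proof -
  have len: "length h = n" and h: "h \<in> lists (state_actions M)"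
    using assms by (auto simp: prefixes_def)
  define x where "x = restrict (\<lambda>i. h ! i) {0..<n}"
  have x: "x \<in> {0..<n} \<rightarrow>\<^sub>E state_actions M"
    using len h by (auto simp: x_def in_lists_conv_set)
  have mapx: "map x [0..<n] = h"
    using len by (auto simp: x_def intro: nth_equalityI)
  have eq: "{\<omega> \<in> space (traj_measure M \<pi>). map \<omega> [0..<n] = h} = IT.PF.emb UNIV {0..<n} {x}"
  proof -
    have "map \<omega> [0..<n] = h \<longleftrightarrow> restrict \<omega> {0..<n} = x" for \<omega>
      using len by (auto simp: x_def list_eq_iff_nth_eq fun_eq_iff restrict_def split: if_splits)
    then show ?thesis
      by (auto simp: prod_emb_def space_traj space_PiM)
  qed
  have X: "{x} \<in> sets (PiM {0..<n} (\<lambda>_. count_space (state_actions M)))"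
    using x by (simp add: PiM_prefix)
  show "{\<omega> \<in> space (traj_measure M \<pi>). map \<omega> [0..<n] = h} \<in> sets (traj_measure M \<pi>)"
    unfolding eq sets_traj using X by (intro measurable_prod_emb) auto
  have "emeasure (traj_measure M \<pi>) (IT.PF.emb UNIV {0..<n} {x}) = emeasure (IT.CI {0..<n}) {x}"
    unfolding traj_measure_eq using X by (intro IT.lim) auto
  also have "\<dots> = emeasure (IT.C 0 n (\<lambda>_. undefined)) {x}"
    using IT.emeasure_CI[of "{0..<n}" n "{x}"] X x by (simp add: prod_emb_id PiM_prefix[symmetric] sets.sets_into_space)
  also have "\<dots> = ennreal (prefix_prob M \<pi> h)"
    using emeasure_C_prefix[OF x] mapx by simp
  finally show "measure (traj_measure M \<pi>) {\<omega> \<in> space (traj_measure M \<pi>). map \<omega> [0..<n] = h} = prefix_prob M \<pi> h"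
    unfolding eq by (simp add: measure_def prefix_prob_nonneg[OF M h])
qed

lemma prefix_events:
  shows "{\<omega> \<in> space (traj_measure M \<pi>). Q (map \<omega> [0..<n])} \<in> sets (traj_measure M \<pi>)"
    and "measure (traj_measure M \<pi>) {\<omega> \<in> space (traj_measure M \<pi>). Q (map \<omega> [0..<n])} =
      (\<Sum>h\<in>prefixes M n. prefix_prob M \<pi> h * of_bool (Q h))"
proof -
  let ?E = "\<lambda>h. {\<omega> \<in> space (traj_measure M \<pi>). map \<omega> [0..<n] = h}"
  have eq: "{\<omega> \<in> space (traj_measure M \<pi>). Q (map \<omega> [0..<n])} = (\<Union>h\<in>{h\<in>prefixes M n. Q h}. ?E h)"
    by (auto simp: space_traj prefixes_def PiE_iff)
  have fin: "finite {h\<in>prefixes M n. Q h}"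
    using finite_prefixes[OF M] by simp
  show "{\<omega> \<in> space (traj_measure M \<pi>). Q (map \<omega> [0..<n])} \<in> sets (traj_measure M \<pi>)"
    unfolding eq using fin prefix_event(1) by (intro sets.finite_UN) auto
  have "measure (traj_measure M \<pi>) (\<Union>h\<in>{h\<in>prefixes M n. Q h}. ?E h) =
      (\<Sum>h\<in>{h\<in>prefixes M n. Q h}. measure (traj_measure M \<pi>) (?E h))"
    using fin prefix_event(1)
    by (intro traj.finite_measure_finite_Union) (auto simp: disjoint_family_on_def)
  also have "\<dots> = (\<Sum>h\<in>{h\<in>prefixes M n. Q h}. prefix_prob M \<pi> h)"
    using prefix_event(2) by (intro sum.cong) auto
  also have "\<dots> = (\<Sum>h\<in>prefixes M n. prefix_prob M \<pi> h * of_bool (Q h))"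
    using finite_prefixes[OF M] by (intro sum.mono_neutral_cong_left) auto
  finally show "measure (traj_measure M \<pi>) {\<omega> \<in> space (traj_measure M \<pi>). Q (map \<omega> [0..<n])} =
      (\<Sum>h\<in>prefixes M n. prefix_prob M \<pi> h * of_bool (Q h))"
    unfolding eq .
qed

text \<open>Continuity of the measure from below, for an event that is witnessed by a finite prefix
  and stays witnessed. Reachability and automaton acceptance both have this form, so the measures of
  the two models are compared through finite sums only.\<close>

lemma path_prob_tendsto:
  assumes mono: "\<And>\<omega> m n. m \<le> n \<Longrightarrow> Q (map \<omega> [0..<m]) \<Longrightarrow> Q (map \<omega> [0..<n])"
    and E: "\<And>\<omega>. range \<omega> \<subseteq> state_actions M \<Longrightarrow> E (\<lambda>t. fst (\<omega> t)) \<longleftrightarrow> (\<exists>n. Q (map \<omega> [0..<n]))"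
  shows "(\<lambda>n. \<Sum>h\<in>prefixes M n. prefix_prob M \<pi> h * of_bool (Q h)) \<longlonglongrightarrow> path_prob M \<pi> E"
proof -
  let ?A = "\<lambda>n. {\<omega> \<in> space (traj_measure M \<pi>). Q (map \<omega> [0..<n])}"
  have eq: "{\<omega> \<in> space (traj_measure M \<pi>). E (\<lambda>t. fst (\<omega> t))} = (\<Union>n. ?A n)"
    using E by (auto simp: space_traj PiE_iff image_subset_iff)
  have "(\<lambda>n. measure (traj_measure M \<pi>) (?A n)) \<longlonglongrightarrow> measure (traj_measure M \<pi>) (\<Union>n. ?A n)"
    using prefix_events(1) mono
    by (intro traj.finite_Lim_measure_incseq) (auto simp: incseq_def)
  then show ?thesis
    unfolding path_prob_def eq prefix_events(2) .
qed

section \<open>Expectations at a fixed time\<close>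

definition state_exp :: "nat \<Rightarrow> ('s \<Rightarrow> real) \<Rightarrow> real" where
  "state_exp n V = (\<Sum>h\<in>prefixes M (Suc n). prefix_prob M \<pi> h * V (fst (last h)))"

text \<open>Time starts at 0, so the pair at time \<open>n\<close> is the last one of a prefix of
  length \<open>Suc n\<close>.\<close>

definition state_action_exp :: "nat \<Rightarrow> ('s \<times> 'a \<Rightarrow> real) \<Rightarrow> real" where
  "state_action_exp n F = (\<Sum>h\<in>prefixes M (Suc n). prefix_prob M \<pi> h * F (last h))"

lemma sum_step_prob:
  assumes h: "h \<in> prefixes M n"
  shows "(\<Sum>x\<in>state_actions M. step_prob M \<pi> h x * V (fst x)) =
    (\<Sum>s\<in>states M. (if h = [] then init M s else trans M (fst (last h)) (snd (last h)) s) * V s)"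
proof -
  let ?g = "\<lambda>s. (if h = [] then init M s else trans M (fst (last h)) (snd (last h)) s) * V s"
  have "h \<in> lists (state_actions M)"
    using h by (simp add: prefixes_def)
  then have supp: "set_pmf (\<pi> h s (length h)) \<subseteq> allowed M s" if "s \<in> states M" for s
    using that by (rule policies_supp[OF \<pi>])
  have "(\<Sum>x\<in>state_actions M. step_prob M \<pi> h x * V (fst x)) =
      (\<Sum>(s, a)\<in>state_actions M. ?g s * pmf (\<pi> h s (length h)) a)"
    by (intro sum.cong) (auto simp: step_prob_def)
  also have "\<dots> = (\<Sum>s\<in>states M. ?g s)"
    by (rule sum_state_actions[OF M supp])
  finally show ?thesis .
qed

lemma state_exp_0: "state_exp 0 V = (\<Sum>s\<in>states M. init M s * V s)"
proof -
  have [simp]: "prefixes M 0 = {[]}"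
    by (auto simp: prefixes_def)
  show ?thesis
    using sum_step_prob[of "[]" 0 V]
    by (simp add: state_exp_def sum_prefixes_Suc prefix_prob_snoc[of _ _ "[]", simplified])
qed

lemma state_exp_Suc:
  "state_exp (Suc n) V = state_action_exp n (\<lambda>(s, a). \<Sum>s'\<in>states M. trans M s a s' * V s')"
proof -
  have "state_exp (Suc n) V =
      (\<Sum>h\<in>prefixes M (Suc n). prefix_prob M \<pi> h * (\<Sum>x\<in>state_actions M. step_prob M \<pi> h x * V (fst x)))"
    unfolding state_exp_def
    by (subst sum_prefixes_Suc) (simp add: prefix_prob_snoc sum_distrib_left mult.assoc)
  also have "\<dots> = state_action_exp n (\<lambda>(s, a). \<Sum>s'\<in>states M. trans M s a s' * V s')"
    unfolding state_action_exp_def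
  proof (rule sum.cong[OF refl])
    fix h assume h: "h \<in> prefixes M (Suc n)"
    then have "h \<noteq> []"
      by (auto simp: prefixes_def)
    then show "prefix_prob M \<pi> h * (\<Sum>x\<in>state_actions M. step_prob M \<pi> h x * V (fst x)) =
        prefix_prob M \<pi> h * (case last h of (s, a) \<Rightarrow> \<Sum>s'\<in>states M. trans M s a s' * V s')"
      unfolding sum_step_prob[OF h] by (simp add: case_prod_beta)
  qed
  finally show ?thesis .
qed

lemma state_action_exp_mono:
  assumes "\<And>s a. s \<in> states M \<Longrightarrow> a \<in> allowed M s \<Longrightarrow> F (s, a) \<le> G (s, a)"
  shows "state_action_exp n F \<le> state_action_exp n G"
  unfolding state_action_exp_def
proof (intro sum_mono mult_left_mono)
  fix h assume h: "h \<in> prefixes M (Suc n)"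
  then have "last h \<in> set h"
    by (intro last_in_set) (auto simp: prefixes_def)
  with h have "last h \<in> state_actions M"
    by (auto simp: prefixes_def)
  with assms show "F (last h) \<le> G (last h)"
    by (cases "last h") (auto simp: state_actions_def)
  show "0 \<le> prefix_prob M \<pi> h"
    using h by (intro prefix_prob_nonneg[OF M]) (simp add: prefixes_def)
qed

lemma state_exp_conv: "state_exp n V = state_action_exp n (\<lambda>(s, a). V s)"
  by (simp add: state_exp_def state_action_exp_def case_prod_beta)

lemma state_exp_mono:
  assumes "\<And>s. s \<in> states M \<Longrightarrow> V s \<le> W s"
  shows "state_exp n V \<le> state_exp n W"
  unfolding state_exp_conv using assms by (intro state_action_exp_mono) auto

lemma state_exp_cong:
  assumes "\<And>s. s \<in> states M \<Longrightarrow> V s = W s"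
  shows "state_exp n V = state_exp n W"
  using assms by (intro antisym state_exp_mono) auto

lemma state_exp_linear: "state_exp n (\<lambda>s. a * V s + b * W s) = a * state_exp n V + b * state_exp n W"
  by (simp add: state_exp_def sum_distrib_left sum.distrib algebra_simps)

lemma state_exp_nonneg:
  assumes "\<And>s. s \<in> states M \<Longrightarrow> 0 \<le> V s"
  shows "0 \<le> state_exp n V"
  using state_exp_mono[of "\<lambda>_. 0" V n] assms by (simp add: state_exp_def)

text \<open>A stationary rule draws the last action from the current state alone, so that action can
  be averaged out given the state.\<close>

lemma state_action_exp_stationary:
  assumes f: "\<And>h s. h \<in> lists (state_actions M) \<Longrightarrow> s \<in> states M \<Longrightarrow> \<pi> h s (length h) = f s"
  shows "state_action_exp n F = state_exp n (\<lambda>s. measure_pmf.expectation (f s) (\<lambda>a. F (s, a)))"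
proof -
  have fin: "finite (allowed M s)" "finite (states M)" if "s \<in> states M" for s
    using M that by (auto simp: is_mdp_def intro: finite_subset)
  have finS: "finite (states M)"
    using M by (auto simp: is_mdp_def)
  have supp: "set_pmf (f s) \<subseteq> allowed M s" if "s \<in> states M" for s
    using policies_supp[OF \<pi> lists.Nil that] f[of "[]" s] that by simp
  have E: "measure_pmf.expectation (f s) (\<lambda>a. F (s, a)) = (\<Sum>a\<in>allowed M s. pmf (f s) a * F (s, a))"
    if "s \<in> states M" for s
    using supp fin that by (subst integral_measure_pmf[of "allowed M s"]) auto
  have "(\<Sum>x\<in>state_actions M. step_prob M \<pi> h x * F x) =
      (\<Sum>x\<in>state_actions M. step_prob M \<pi> h x * measure_pmf.expectation (f (fst x)) (\<lambda>a. F (fst x, a)))"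
    if h: "h \<in> prefixes M n" for h
  proof -
    have hl: "h \<in> lists (state_actions M)"
      using h by (simp add: prefixes_def)
    let ?g = "\<lambda>s. if h = [] then init M s else trans M (fst (last h)) (snd (last h)) s"
    have "(\<Sum>x\<in>state_actions M. step_prob M \<pi> h x * F x) =
        (\<Sum>(s, a)\<in>state_actions M. ?g s * pmf (f s) a * F (s, a))"
      using f[OF hl] by (intro sum.cong) (auto simp: step_prob_def state_actions_def)
    also have "\<dots> = (\<Sum>s\<in>states M. \<Sum>a\<in>allowed M s. ?g s * pmf (f s) a * F (s, a))"
      unfolding state_actions_def using fin finS by (subst sum.Sigma) auto
    also have "\<dots> = (\<Sum>s\<in>states M. ?g s * measure_pmf.expectation (f s) (\<lambda>a. F (s, a)))"
      by (intro sum.cong) (simp_all add: E sum_distrib_left mult.assoc)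
    also have "\<dots> = (\<Sum>x\<in>state_actions M. step_prob M \<pi> h x * measure_pmf.expectation (f (fst x)) (\<lambda>a. F (fst x, a)))"
      using sum_step_prob[OF h, of "\<lambda>s. measure_pmf.expectation (f s) (\<lambda>a. F (s, a))"] by simp
    finally show ?thesis .
  qed
  then show ?thesis
    unfolding state_action_exp_def state_exp_def sum_prefixes_Suc
    by (simp add: prefix_prob_snoc mult.assoc flip: sum_distrib_left)
qed

text \<open>A prefix that leaves a closed set contains a step of probability zero.\<close>

lemma prefix_prob_closed:
  assumes Y: "\<And>s a s'. s \<in> Y \<Longrightarrow> (s, a) \<in> state_actions M \<Longrightarrow> s' \<in> states M \<Longrightarrow> trans M s a s' \<noteq> 0 \<Longrightarrow> s' \<in> Y"
    and "h \<in> lists (state_actions M)" "prefix_prob M \<pi> h \<noteq> 0" "x \<in> set h" "fst x \<in> Y"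
  shows "fst (last h) \<in> Y"
  using assms(2-)
proof (induction h rule: rev_induct)
  case (snoc y h)
  show ?case
  proof (cases "x \<in> set h")
    case True
    then have "h \<noteq> []"
      by auto
    moreover have "last h \<in> state_actions M"
      using snoc.prems last_in_set[OF \<open>h \<noteq> []\<close>] by auto
    moreover have "fst (last h) \<in> Y"
      using snoc True by (auto simp: prefix_prob_snoc)
    moreover have "step_prob M \<pi> h y \<noteq> 0" "y \<in> state_actions M"
      using snoc.prems by (auto simp: prefix_prob_snoc)
    ultimately show ?thesis
      using Y[of "fst (last h)" "snd (last h)" "fst y"]
      by (auto simp: step_prob_def state_actions_def)
  next
    case False
    with snoc.prems show ?thesis by auto
  qed
qed simp

lemma reach_prefix_tendsto:
  "(\<lambda>n. \<Sum>h\<in>prefixes M n. prefix_prob M \<pi> h * of_bool (\<exists>x\<in>set h. fst x \<in> Y))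
    \<longlonglongrightarrow> path_prob M \<pi> (\<lambda>\<sigma>. reaches \<sigma> Y)"
proof (rule path_prob_tendsto)
  show "\<exists>x\<in>set (map \<omega> [0..<n]). fst x \<in> Y" if "m \<le> n" "\<exists>x\<in>set (map \<omega> [0..<m]). fst x \<in> Y" for \<omega> m n
    using that by (auto intro: less_le_trans)
  show "reaches (\<lambda>t. fst (\<omega> t)) Y \<longleftrightarrow> (\<exists>n. \<exists>x\<in>set (map \<omega> [0..<n]). fst x \<in> Y)" for \<omega>
    unfolding reaches_def
  proof
    assume "\<exists>t. fst (\<omega> t) \<in> Y"
    then obtain t where "fst (\<omega> t) \<in> Y" ..
    then show "\<exists>n. \<exists>x\<in>set (map \<omega> [0..<n]). fst x \<in> Y"
      by (intro exI[of _ "Suc t"]) auto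
  qed auto
qed

text \<open>For a closed \<open>Y\<close>, having visited it up to time \<open>n\<close> and being
  in it at time \<open>n\<close> differ only on prefixes of probability zero. Reachability thus
  becomes the limit of expectations of one function of the state.\<close>

lemma reach_tendsto:
  assumes Y: "\<And>s a s'. s \<in> Y \<Longrightarrow> (s, a) \<in> state_actions M \<Longrightarrow> s' \<in> states M \<Longrightarrow> trans M s a s' \<noteq> 0 \<Longrightarrow> s' \<in> Y"
  shows "(\<lambda>n. state_exp n (indicator Y)) \<longlonglongrightarrow> path_prob M \<pi> (\<lambda>\<sigma>. reaches \<sigma> Y)"
proof -
  from LIMSEQ_Suc[OF reach_prefix_tendsto] show ?thesis
  proof (rule Lim_transform_eventually[OF _ always_eventually], intro allI)
    fix n
    show "(\<Sum>h\<in>prefixes M (Suc n). prefix_prob M \<pi> h * of_bool (\<exists>x\<in>set h. fst x \<in> Y)) = state_exp n (indicator Y)"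
      unfolding state_exp_def
    proof (rule sum.cong[OF refl])
      fix h assume h: "h \<in> prefixes M (Suc n)"
      then have "last h \<in> set h"
        by (intro last_in_set) (auto simp: prefixes_def)
      with h prefix_prob_closed[of Y h, OF Y]
      show "prefix_prob M \<pi> h * of_bool (\<exists>x\<in>set h. fst x \<in> Y) = prefix_prob M \<pi> h * indicator Y (fst (last h))"
        by (cases "prefix_prob M \<pi> h = 0") (auto simp: prefixes_def indicator_def)
    qed
  qed
qed

end

section \<open>Discounted and undiscounted reachability\<close>

definition absorbing :: "('s, 'a, 'm) mdp_scheme \<Rightarrow> 's set \<Rightarrow> bool" where
  "absorbing M Y \<longleftrightarrow>
    (\<forall>s\<in>Y. \<forall>a. (s, a) \<in> state_actions M \<longrightarrow> (\<forall>s'\<in>states M. trans M s a s' \<noteq> 0 \<longrightarrow> s' \<in> Y))"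

definition rule_kernel :: "('s, 'a, 'm) mdp_scheme \<Rightarrow> ('s \<Rightarrow> 'a pmf) \<Rightarrow> 's \<Rightarrow> 's \<Rightarrow> real" where
  "rule_kernel M f s s' = measure_pmf.expectation (f s) (\<lambda>a. trans M s a s')"

definition stat_policy :: "('s \<Rightarrow> 'a pmf) \<Rightarrow> ('s, 'a) policy" where
  "stat_policy f = (\<lambda>h s t. f s)"

lemma stationary_stat_policy: "stationary M (stat_policy f)"
  by (auto simp: stationary_def stat_policy_def)

lemma finite_allowed: "is_mdp M \<Longrightarrow> s \<in> states M \<Longrightarrow> finite (allowed M s)"
  by (auto simp: is_mdp_def intro: finite_subset)

lemma finite_states: "is_mdp M \<Longrightarrow> finite (states M)"
  by (simp add: is_mdp_def)

lemma init_nonneg: "is_mdp M \<Longrightarrow> s \<in> states M \<Longrightarrow> 0 \<le> init M s"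
  by (simp add: is_mdp_def)

lemma stat_policy_in_policies:
  "stat_policy f \<in> policies M \<longleftrightarrow> (\<forall>s\<in>states M. set_pmf (f s) \<subseteq> allowed M s)"
  unfolding policies_def stat_policy_def by auto

lemma kop_rule_kernel:
  assumes M: "is_mdp M" and s: "s \<in> states M" and f: "set_pmf (f s) \<subseteq> allowed M s"
  shows "kop (states M) (rule_kernel M f) V s =
    measure_pmf.expectation (f s) (\<lambda>a. \<Sum>s'\<in>states M. trans M s a s' * V s')"
proof -
  have E: "measure_pmf.expectation (f s) F = (\<Sum>a\<in>allowed M s. pmf (f s) a * F a)" for F :: "_ \<Rightarrow> real"
    using f finite_allowed[OF M s] by (subst integral_measure_pmf[of "allowed M s"]) auto
  show ?thesis
    unfolding kop_def rule_kernel_def E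
    by (simp add: sum_distrib_left sum_distrib_right mult.assoc) (rule sum.swap)
qed

lemma stochastic_rule_kernel:
  assumes M: "is_mdp M" and f: "\<And>s. s \<in> states M \<Longrightarrow> set_pmf (f s) \<subseteq> allowed M s"
  shows "stochastic_kernel (states M) (rule_kernel M f)"
proof
  show "0 \<le> rule_kernel M f s s'" if "s \<in> states M" "s' \<in> states M" for s s'
    unfolding rule_kernel_def using f[OF that(1)] that trans_nonneg[OF M]
    by (intro integral_nonneg_AE) (auto simp: AE_measure_pmf_iff)
  show "(\<Sum>s'\<in>states M. rule_kernel M f s s') = 1" if "s \<in> states M" for s
  proof -
    have "(\<Sum>s'\<in>states M. rule_kernel M f s s') =
        measure_pmf.expectation (f s) (\<lambda>a. \<Sum>s'\<in>states M. trans M s a s')"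
      using kop_rule_kernel[of M s f "\<lambda>_. 1"] M that f[OF that] by (simp add: kop_def)
    also have "\<dots> = measure_pmf.expectation (f s) (\<lambda>a. 1)"
      using f[OF that] that trans_sum[OF M]
      by (intro integral_cong_AE) (auto simp: AE_measure_pmf_iff)
    finally show ?thesis by simp
  qed
qed (rule finite_states[OF M])

text \<open>Supplies, action by action, the growth condition \<open>g \<le> kop S K g\<close> of the
  kernel lemmas; from a state of \<open>Y\<close> the whole unit mass of the row stays in
  \<open>Y\<close>.\<close>

lemma indicator_le_trans:
  assumes M: "is_mdp M" and Y: "absorbing M Y" and sa: "s \<in> states M" "a \<in> allowed M s"
  shows "indicator Y s \<le> (\<Sum>s'\<in>states M. trans M s a s' * indicator Y s')"
proof (cases "s \<in> Y")
  case True
  have "(\<Sum>s'\<in>states M. trans M s a s' * indicator Y s') = (\<Sum>s'\<in>states M. trans M s a s')"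
    using Y True sa by (intro sum.cong) (auto simp: absorbing_def state_actions_def indicator_def)
  with trans_sum[OF M sa] True show ?thesis by simp
next
  case False
  then show ?thesis
    using trans_nonneg[OF M sa] by (auto intro!: sum_nonneg)
qed

lemma indicator_le_kop:
  assumes M: "is_mdp M" and f: "\<And>s. s \<in> states M \<Longrightarrow> set_pmf (f s) \<subseteq> allowed M s"
    and Y: "absorbing M Y" and s: "s \<in> states M"
  shows "indicator Y s \<le> kop (states M) (rule_kernel M f) (indicator Y) s"
proof -
  have "measure_pmf.expectation (f s) (\<lambda>a. indicator Y s) \<le>
      measure_pmf.expectation (f s) (\<lambda>a. \<Sum>s'\<in>states M. trans M s a s' * indicator Y s')"
    using f[OF s] finite_subset[OF f[OF s] finite_allowed[OF M s]] indicator_le_trans[OF M Y s]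
    by (intro integral_mono_AE integrable_measure_pmf_finite) (auto simp: AE_measure_pmf_iff)
  then show ?thesis
    by (simp add: kop_rule_kernel[where f = f, OF M s f[OF s]])
qed

context mdp_policy
begin

lemma state_exp_le_Suc:
  assumes "absorbing M Y"
  shows "state_exp n (indicator Y) \<le> state_exp (Suc n) (indicator Y)"
  unfolding state_exp_conv[of n] state_exp_Suc
  using indicator_le_trans[OF M assms] by (intro state_action_exp_mono) auto

lemma state_exp_tendsto_reach:
  assumes "absorbing M Y"
  shows "(\<lambda>n. state_exp n (indicator Y)) \<longlonglongrightarrow> path_prob M \<pi> (\<lambda>\<sigma>. reaches \<sigma> Y)"
  using assms by (intro reach_tendsto) (auto simp: absorbing_def)

end

text \<open>Under a stationary rule the states form a Markov chain, so the expectation of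
  \<open>V\<close> at time \<open>n\<close> is the initial distribution applied to the
  \<open>n\<close>-th iterate of the kernel on \<open>V\<close>; then \<open>n\<close> tends to
  infinity with \<open>V = indicator Y\<close>.\<close>

lemma path_prob_stat_policy:
  assumes M: "is_mdp M" and f: "\<And>s. s \<in> states M \<Longrightarrow> set_pmf (f s) \<subseteq> allowed M s"
    and Y: "absorbing M Y"
  shows "path_prob M (stat_policy f) (\<lambda>\<sigma>. reaches \<sigma> Y) =
    (\<Sum>s\<in>states M. init M s * hit_val (states M) (rule_kernel M f) (indicator Y) s)"
proof -
  interpret mdp_policy M "stat_policy f"
    using M f by unfold_locales (auto simp: stat_policy_in_policies)
  interpret K: stochastic_kernel "states M" "rule_kernel M f"
    by (rule stochastic_rule_kernel[OF M f])
  have Suc: "state_exp (Suc n) V = state_exp n (kop (states M) (rule_kernel M f) V)" for n V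
  proof -
    have "state_exp (Suc n) V = state_exp n (\<lambda>s. measure_pmf.expectation (f s)
        (\<lambda>a. \<Sum>s'\<in>states M. trans M s a s' * V s'))"
      unfolding state_exp_Suc by (subst state_action_exp_stationary[of f]) (auto simp: stat_policy_def)
    also have "\<dots> = state_exp n (kop (states M) (rule_kernel M f) V)"
      by (intro state_exp_cong) (simp add: kop_rule_kernel[OF M _ f])
    finally show ?thesis .
  qed
  have "state_exp n V = (\<Sum>s\<in>states M. init M s * (kop (states M) (rule_kernel M f) ^^ n) V s)" for n V
    by (induction n arbitrary: V) (simp_all add: state_exp_0 Suc funpow_swap1)
  then have "(\<lambda>n. \<Sum>s\<in>states M. init M s * (kop (states M) (rule_kernel M f) ^^ n) (indicator Y) s)
      \<longlonglongrightarrow> path_prob M (stat_policy f) (\<lambda>\<sigma>. reaches \<sigma> Y)"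
    using state_exp_tendsto_reach[OF Y] by simp
  moreover have "(\<lambda>n. \<Sum>s\<in>states M. init M s * (kop (states M) (rule_kernel M f) ^^ n) (indicator Y) s)
      \<longlonglongrightarrow> (\<Sum>s\<in>states M. init M s * hit_val (states M) (rule_kernel M f) (indicator Y) s)"
    by (intro tendsto_intros K.tendsto_hit_val indicator_le_kop[OF M f Y]) auto
  ultimately show ?thesis
    by (rule LIMSEQ_unique)
qed

text \<open>In a state without allowed actions no distribution is possible, so no policy exists at
  all. The theorem obtains \<open>live\<close> from a feasible policy.\<close>

locale live_mdp =
  fixes M :: "('s, 'a, 'm) mdp_scheme"
  assumes M: "is_mdp M"
    and live: "\<And>s. s \<in> states M \<Longrightarrow> allowed M s \<noteq> {}"
begin

abbreviation "S \<equiv> states M"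

text \<open>Extensional functions, which makes the set of rules finite and rules that agree on
  \<open>S\<close> equal.\<close>

definition det :: "('s \<Rightarrow> 'a) set" where
  "det = PiE S (allowed M)"

definition det_kernel :: "('s \<Rightarrow> 'a) \<Rightarrow> 's \<Rightarrow> 's \<Rightarrow> real" where
  "det_kernel d s s' = trans M s (d s) s'"

definition disc_val :: "real \<Rightarrow> ('s \<Rightarrow> real) \<Rightarrow> ('s \<Rightarrow> 'a) \<Rightarrow> real" where
  "disc_val l g d = (\<Sum>s\<in>S. init M s * green S (det_kernel d) l g s)"

definition reach_val :: "'s set \<Rightarrow> ('s \<Rightarrow> 'a) \<Rightarrow> real" where
  "reach_val Y d = (\<Sum>s\<in>S. init M s * hit_val S (det_kernel d) (indicator Y) s)"

text \<open>Optimality is expressed by a local inequality for each state and action, with the value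
  function of \<open>d\<close> itself on both sides. In this form it can be checked after changing
  single states, and it is a closed condition on the weight of the objective.\<close>

definition bellman_opt :: "real \<Rightarrow> ('s \<Rightarrow> real) \<Rightarrow> ('s \<Rightarrow> 'a) \<Rightarrow> bool" where
  "bellman_opt l g d \<longleftrightarrow> d \<in> det \<and> (\<forall>s\<in>S. \<forall>a\<in>allowed M s.
    g s + l * (\<Sum>s'\<in>S. trans M s a s' * green S (det_kernel d) l g s') \<le> green S (det_kernel d) l g s)"

lemma det_allowed: "d \<in> det \<Longrightarrow> s \<in> S \<Longrightarrow> d s \<in> allowed M s"
  by (auto simp: det_def)

lemma fun_upd_det: "d \<in> det \<Longrightarrow> s \<in> S \<Longrightarrow> a \<in> allowed M s \<Longrightarrow> d(s := a) \<in> det"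
  by (auto simp: det_def PiE_iff extensional_def)

lemma finite_det: "finite det"
  unfolding det_def using finite_states[OF M] finite_allowed[OF M] by (intro finite_PiE)

lemma det_nonempty: "det \<noteq> {}"
  unfolding det_def using live by (simp add: PiE_eq_empty_iff)

lemma states_nonempty: "S \<noteq> {}"
  using M by (auto simp: is_mdp_def)

lemma det_kernel_conv: "det_kernel d = rule_kernel M (\<lambda>s. return_pmf (d s))"
  by (simp add: fun_eq_iff det_kernel_def rule_kernel_def)

lemma stochastic_det_kernel: "d \<in> det \<Longrightarrow> stochastic_kernel S (det_kernel d)"
  unfolding det_kernel_conv by (intro stochastic_rule_kernel M) (auto simp: det_allowed)

lemma kop_det_kernel: "kop S (det_kernel d) V s = (\<Sum>s'\<in>S. trans M s (d s) s' * V s')"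
  by (simp add: kop_def det_kernel_def)

section \<open>Bellman optimal rules with discount\<close>

lemma ex_bellman_opt:
  assumes l: "0 \<le> l" "l < 1"
  shows "\<exists>d. bellman_opt l g d"
proof -
  let ?V = "\<lambda>d. green S (det_kernel d) l g"
  \<comment> \<open>All states have weight 1 here instead of \<open>init\<close>: an improvement in
    any state, reachable or not, then increases \<open>?F\<close> strictly and contradicts the
    choice of \<open>d\<close>.\<close>
  let ?F = "\<lambda>d. \<Sum>s\<in>S. ?V d s"
  have "Max (?F ` det) \<in> ?F ` det"
    using finite_det det_nonempty by (intro Max_in) auto
  then obtain d where d: "d \<in> det" and "?F d = Max (?F ` det)"
    by auto
  then have max: "?F e \<le> ?F d" if "e \<in> det" for e
    using that finite_det by (auto intro: Max_ge)
  interpret K: stochastic_kernel S "det_kernel d"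
    by (rule stochastic_det_kernel[OF d])
  have "g s + l * (\<Sum>s'\<in>S. trans M s a s' * ?V d s') \<le> ?V d s" if sa: "s \<in> S" "a \<in> allowed M s" for s a
  proof (rule ccontr)
    assume "\<not> ?thesis"
    then have better: "?V d s < g s + l * (\<Sum>s'\<in>S. trans M s a s' * ?V d s')"
      by simp
    define e where "e = d(s := a)"
    have e: "e \<in> det"
      unfolding e_def using d sa by (rule fun_upd_det)
    interpret K': stochastic_kernel S "det_kernel e"
      by (rule stochastic_det_kernel[OF e])
    \<comment> \<open>The old values form a sub-solution for the changed rule, so no state loses;
      state \<open>s\<close> gains strictly.\<close>
    have sub: "?V d x \<le> g x + l * kop S (det_kernel e) (?V d) x" if "x \<in> S" for x
      using better K.green_eq[OF l that, of g] by (cases "x = s") (auto simp: kop_det_kernel e_def)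
    have le: "?V d x \<le> ?V e x" if "x \<in> S" for x
      using K'.green_eq[OF l] that by (intro K'.discounted_le[OF l sub]) auto
    have "?V d s < g s + l * kop S (det_kernel e) (?V d) s"
      using better by (simp add: kop_det_kernel e_def)
    also have "\<dots> \<le> g s + l * kop S (det_kernel e) (?V e) s"
      using le l sa by (auto intro!: mult_left_mono K'.kop_mono)
    also have "\<dots> = ?V e s"
      using K'.green_eq[OF l sa(1)] by simp
    finally have "?F d < ?F e"
      using le sa finite_states[OF M] by (intro sum_strict_mono_ex1) auto
    with max[OF e] show False by simp
  qed
  with d show ?thesis
    by (auto simp: bellman_opt_def)
qed

text \<open>The value function of \<open>d\<close> is a super-solution for the kernel of every rule.
  Applied both ways, all optimal rules share one value function.\<close>

lemma bellman_opt_unique: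
  assumes l: "0 \<le> l" "l < 1" and d: "bellman_opt l g d" and e: "e \<in> det" and s: "s \<in> S"
  shows "green S (det_kernel e) l g s \<le> green S (det_kernel d) l g s"
proof -
  interpret K': stochastic_kernel S "det_kernel e"
    by (rule stochastic_det_kernel[OF e])
  show ?thesis
    using d det_allowed[OF e] K'.green_eq[OF l]
    by (intro K'.discounted_le[OF l _ _ s]) (auto simp: bellman_opt_def kop_det_kernel)
qed

text \<open>\<open>d\<close> and \<open>d'\<close> share their value function, and in each state
  both actions attain it. Choosing between them state by state still solves the same equation, which
  has one solution for \<open>l < 1\<close>.\<close>

lemma bellman_opt_switch:
  assumes l: "0 \<le> l" "l < 1" and d: "bellman_opt l g d" and d': "bellman_opt l g d'"
    and e: "e \<in> det" "\<And>s. s \<in> S \<Longrightarrow> e s = d s \<or> e s = d' s"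
  shows "bellman_opt l g e"
proof -
  have dd: "d \<in> det" "d' \<in> det"
    using d d' by (auto simp: bellman_opt_def)
  interpret K: stochastic_kernel S "det_kernel d"
    by (rule stochastic_det_kernel[OF dd(1)])
  interpret K': stochastic_kernel S "det_kernel d'"
    by (rule stochastic_det_kernel[OF dd(2)])
  interpret E: stochastic_kernel S "det_kernel e"
    by (rule stochastic_det_kernel[OF e(1)])
  let ?V = "green S (det_kernel d) l g"
  have eq': "green S (det_kernel d') l g s = ?V s" if "s \<in> S" for s
    using bellman_opt_unique[OF l d dd(2) that] bellman_opt_unique[OF l d' dd(1) that] by simp
  have "?V s = green S (det_kernel e) l g s" if "s \<in> S" for s
  proof (rule E.green_unique[OF l _ that])
    fix s assume s: "s \<in> S"
    have "kop S (det_kernel d') (green S (det_kernel d') l g) s = kop S (det_kernel d') ?V s"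
      using eq' by (intro kop_cong) auto
    then have "?V s = g s + l * kop S (det_kernel d') ?V s"
      using K'.green_eq[OF l s, of g] eq'[OF s] by simp
    then show "?V s = g s + l * kop S (det_kernel e) ?V s"
      using K.green_eq[OF l s, of g] e(2)[OF s] by (auto simp: kop_det_kernel)
  qed
  then have V: "green S (det_kernel e) l g s = ?V s" if "s \<in> S" for s
    using that by simp
  have "(\<Sum>s'\<in>S. trans M s a s' * green S (det_kernel e) l g s') = (\<Sum>s'\<in>S. trans M s a s' * ?V s')" for s a
    using V by (intro sum.cong) auto
  with d e(1) V show ?thesis
    by (auto simp: bellman_opt_def)
qed

text \<open>The discounted reward collected before time \<open>n\<close> plus \<open>l ^ n\<close>
  times the expected value at time \<open>n\<close> does not increase with \<open>n\<close>, since
  the Bellman inequality holds for every allowed action. The policy may depend on the history: only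
  the joint law of state and action at each time enters.\<close>

lemma bellman_opt_bound:
  assumes l: "0 \<le> l" "l < 1" and d: "bellman_opt l g d"
    and g: "\<And>s. s \<in> S \<Longrightarrow> 0 \<le> g s" and \<pi>: "\<pi> \<in> policies M"
  defines "x \<equiv> \<lambda>n. l ^ n * mdp_policy.state_exp M \<pi> n g"
  shows "summable x" "suminf x \<le> disc_val l g d"
proof -
  interpret mdp_policy M \<pi>
    by unfold_locales (rule M \<pi>)+
  interpret K: stochastic_kernel S "det_kernel d"
    using d by (intro stochastic_det_kernel) (simp add: bellman_opt_def)
  let ?V = "green S (det_kernel d) l g"
  have V0: "0 \<le> ?V s" if "s \<in> S" for s
    using K.green_eq[OF l] g that by (intro K.discounted_nonneg[OF l]) auto
  have step: "state_exp n g + l * state_exp (Suc n) ?V \<le> state_exp n ?V" for n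
  proof -
    have "state_exp n g + l * state_exp (Suc n) ?V =
        state_action_exp n (\<lambda>(s, a). g s + l * (\<Sum>s'\<in>S. trans M s a s' * ?V s'))"
      by (simp add: state_exp_Suc) (simp add: state_exp_conv state_action_exp_def sum_distrib_left
          sum.distrib[symmetric] case_prod_beta algebra_simps)
    also have "\<dots> \<le> state_exp n ?V"
      unfolding state_exp_conv using d by (intro state_action_exp_mono) (auto simp: bellman_opt_def)
    finally show ?thesis .
  qed
  have part: "(\<Sum>i<n. x i) + l ^ n * state_exp n ?V \<le> state_exp 0 ?V" for n
  proof (induction n)
    case (Suc n)
    have "l ^ n * (state_exp n g + l * state_exp (Suc n) ?V) \<le> l ^ n * state_exp n ?V"
      using step l by (intro mult_left_mono) auto
    with Suc show ?case
      by (simp add: x_def algebra_simps)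
  qed simp
  have x0: "0 \<le> x n" for n
    unfolding x_def using l g by (intro mult_nonneg_nonneg state_exp_nonneg) auto
  have le: "(\<Sum>i<n. x i) \<le> disc_val l g d" for n
  proof -
    have "0 \<le> l ^ n * state_exp n ?V"
      using l V0 by (intro mult_nonneg_nonneg state_exp_nonneg) auto
    with part[of n] show ?thesis
      by (simp add: state_exp_0 disc_val_def)
  qed
  show "summable x"
    using x0 le[of "Suc n" for n] unfolding lessThan_Suc_atMost by (rule bounded_imp_summable)
  then show "suminf x \<le> disc_val l g d"
    using le by (intro suminf_le_const)
qed

lemma disc_val_linear:
  assumes l: "0 \<le> l" "l < 1" and d: "d \<in> det"
  shows "disc_val l (\<lambda>s. a * g s + b * h s) d = a * disc_val l g d + b * disc_val l h d"
proof -
  interpret K: stochastic_kernel S "det_kernel d"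
    by (rule stochastic_det_kernel[OF d])
  have "disc_val l (\<lambda>s. a * g s + b * h s) d =
      (\<Sum>s\<in>S. init M s * (a * green S (det_kernel d) l g s + b * green S (det_kernel d) l h s))"
    unfolding disc_val_def using K.green_linear[OF l] by (intro sum.cong) auto
  then show ?thesis
    by (simp add: disc_val_def sum_distrib_left sum.distrib algebra_simps)
qed

text \<open>For a fixed rule the discounted values are affine in the weight \<open>k\<close>, so
  each Bellman inequality cuts out a closed set of weights.\<close>

lemma closed_bellman_opt:
  assumes l: "0 \<le> l" "l < 1" and d: "d \<in> det"
  shows "closed {k. bellman_opt l (\<lambda>s. g s + k * h s) d}"
proof -
  interpret K: stochastic_kernel S "det_kernel d"
    by (rule stochastic_det_kernel[OF d])
  let ?G = "green S (det_kernel d) l g" and ?H = "green S (det_kernel d) l h"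
  have lin: "green S (det_kernel d) l (\<lambda>s. g s + k * h s) s = ?G s + k * ?H s" if "s \<in> S" for s k
    using K.green_linear[OF l that, of 1 g k h] by simp
  have *: "(\<Sum>s'\<in>S. trans M s a s' * green S (det_kernel d) l (\<lambda>s. g s + k * h s) s') =
      (\<Sum>s'\<in>S. trans M s a s' * (?G s' + k * ?H s'))" for s a k
    by (intro sum.cong) (auto simp: lin)
  have "{k. bellman_opt l (\<lambda>s. g s + k * h s) d} =
      (\<Inter>s\<in>S. \<Inter>a\<in>allowed M s. {k. g s + k * h s + l * (\<Sum>s'\<in>S. trans M s a s' * (?G s' + k * ?H s'))
        \<le> ?G s + k * ?H s})"
    using d unfolding bellman_opt_def * by (auto simp: lin)
  also have "closed \<dots>"
    by (intro closed_INT ballI closed_Collect_le continuous_intros)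
  finally show ?thesis .
qed

end

section \<open>Stationary optimal policies\<close>

context live_mdp
begin

text \<open>A Lagrange multiplier argument: \<open>k\<close> prices \<open>h\<close>. At a critical
  price one optimal rule reaches the level \<open>u h\<close> and another does not exceed it.
  Interpolating between two neighbouring optimal rules so as to meet \<open>u h\<close> exactly
  still dominates \<open>u g\<close>, because both have weighted value at least
  \<open>u g + k * u h\<close>.\<close>

lemma disc_dominated:
  fixes g h :: "'s \<Rightarrow> real"
  assumes l: "0 \<le> l" "l < 1" and \<pi>: "\<pi> \<in> policies M"
    and g: "\<And>s. s \<in> S \<Longrightarrow> 0 \<le> g s" and h: "\<And>s. s \<in> S \<Longrightarrow> 0 \<le> h s"
  defines "u \<equiv> \<lambda>g. \<Sum>n. l ^ n * mdp_policy.state_exp M \<pi> n g"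
  obtains d t b \<theta> where "d \<in> det" "t \<in> S" "b \<in> allowed M t" "0 \<le> \<theta>" "\<theta> \<le> 1"
    "u g \<le> (1 - \<theta>) * disc_val l g d + \<theta> * disc_val l g (d(t := b))"
    "u h \<le> (1 - \<theta>) * disc_val l h d + \<theta> * disc_val l h (d(t := b))"
proof -
  interpret mdp_policy M \<pi>
    by unfold_locales (rule M \<pi>)+
  let ?J = "disc_val l"
  define opt where "opt k d \<longleftrightarrow> bellman_opt l (\<lambda>s. g s + k * h s) d" for k d
  have opt_det: "d \<in> det" if "opt k d" for k d
    using that by (simp add: opt_def bellman_opt_def)
  have ex_opt: "\<exists>d. opt k d" for k
    unfolding opt_def by (rule ex_bellman_opt[OF l])
  have J_lin: "?J (\<lambda>s. g s + k * h s) d = ?J g d + k * ?J h d" if "d \<in> det" for k d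
    using disc_val_linear[OF l that, of 1 g k h] by simp
  obtain dg where "bellman_opt l g dg"
    using ex_bellman_opt[OF l] by blast
  from bellman_opt_bound(1)[OF l this g \<pi>]
  have sg: "summable (\<lambda>n. l ^ n * state_exp n g)" .
  obtain dh where "bellman_opt l h dh"
    using ex_bellman_opt[OF l] by blast
  from bellman_opt_bound(1)[OF l this h \<pi>]
  have sh: "summable (\<lambda>n. l ^ n * state_exp n h)" .
  have bound: "u g + k * u h \<le> ?J g d + k * ?J h d" if "opt k d" "0 \<le> k" for k d
  proof -
    have lin: "state_exp n (\<lambda>s. g s + k * h s) = state_exp n g + k * state_exp n h" for n
      using state_exp_linear[of n 1 g k h] by simp
    have "(\<Sum>n. l ^ n * state_exp n (\<lambda>s. g s + k * h s)) = (\<Sum>n. l ^ n * state_exp n g + k * (l ^ n * state_exp n h))"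
      unfolding lin by (simp add: distrib_left mult.left_commute)
    also have "\<dots> = u g + k * u h"
      unfolding u_def using sg sh by (subst suminf_add[symmetric]) (auto simp: suminf_mult intro: summable_mult)
    finally have "u g + k * u h \<le> ?J (\<lambda>s. g s + k * h s) d"
      using bellman_opt_bound(2)[OF l that(1)[unfolded opt_def] _ \<pi>] g h that(2) by simp
    then show ?thesis
      by (simp add: J_lin opt_det[OF that(1)])
  qed
  obtain t0 where t0: "t0 \<in> S"
    using states_nonempty by blast
  note result = that
  have single: thesis if "d \<in> det" "u g \<le> ?J g d" "u h \<le> ?J h d" for d
    using that det_allowed[OF that(1) t0] t0 by (intro result[of d t0 "d t0" 0]) auto
  \<comment> \<open>Prices at which some optimal rule reaches (\<open>A\<close>), respectively does
    not exceed (\<open>B\<close>), the level \<open>u h\<close>. Ties go into both sets, so that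
    both are closed and together cover the line.\<close>
  define A where "A = {k. \<exists>d. opt k d \<and> u h \<le> ?J h d}"
  define B where "B = {k. \<exists>d. opt k d \<and> ?J h d \<le> u h}"
  have closed: "closed (\<Union>d\<in>{d \<in> det. P d}. {k. opt k d})" for P
    using finite_det closed_bellman_opt[OF l, of _ g h] unfolding opt_def by (intro closed_UN) auto
  have A: "closed A" and B: "closed B"
  proof -
    have "A = (\<Union>d\<in>{d \<in> det. u h \<le> ?J h d}. {k. opt k d})"
      by (auto simp: A_def dest: opt_det)
    then show "closed A" by (simp only: closed)
    have "B = (\<Union>d\<in>{d \<in> det. ?J h d \<le> u h}. {k. opt k d})"
      by (auto simp: B_def dest: opt_det)
    then show "closed B" by (simp only: closed)
  qed
  have AB: "k \<in> A \<or> k \<in> B" for k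
  proof -
    obtain d where "opt k d"
      using ex_opt by blast
    then show ?thesis
      using linear[of "u h" "?J h d"] by (auto simp: A_def B_def)
  qed
  \<comment> \<open>At a large price, a rule that misses the level \<open>u h\<close> has less
    weighted value than the given policy and cannot be optimal; this puts some \<kappa> into
    \<open>A\<close>.\<close>
  have "eventually (\<lambda>k. \<forall>d\<in>det. ?J h d < u h \<longrightarrow> ?J g d + k * ?J h d < u g + k * u h) at_top"
  proof (intro eventually_ball_finite finite_det ballI)
    fix d
    show "eventually (\<lambda>k. ?J h d < u h \<longrightarrow> ?J g d + k * ?J h d < u g + k * u h) at_top"
    proof (cases "?J h d < u h")
      case True
      show ?thesis
        using eventually_gt_at_top[of "(?J g d - u g) / (u h - ?J h d)"]
        by eventually_elim (use True in \<open>simp add: divide_less_eq algebra_simps\<close>)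
    qed simp
  qed
  then have "eventually (\<lambda>k. 0 \<le> k \<and> (\<forall>d\<in>det. ?J h d < u h \<longrightarrow> ?J g d + k * ?J h d < u g + k * u h)) at_top"
    using eventually_ge_at_top[of "0::real"] by eventually_elim auto
  then obtain \<kappa> where \<kappa>: "0 \<le> \<kappa>" "\<And>d. d \<in> det \<Longrightarrow> ?J h d < u h \<Longrightarrow> ?J g d + \<kappa> * ?J h d < u g + \<kappa> * u h"
    by (auto simp: eventually_at_top_linorder)
  have "\<kappa> \<in> A"
  proof -
    obtain d where "opt \<kappa> d"
      using ex_opt by blast
    with bound[of \<kappa> d] \<kappa> opt_det[of \<kappa> d] show ?thesis
      by (force simp: A_def)
  qed
  show thesis
  proof (cases "0 \<in> A")
    case True
    then obtain d where "opt 0 d" "u h \<le> ?J h d"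
      by (auto simp: A_def)
    with bound[of 0 d] show thesis
      by (intro single[of d]) (auto simp: opt_det)
  next
    case False
    with AB have "0 \<in> B"
      by blast
    \<comment> \<open>The interval is connected, so two closed sets that cover it and both meet it
      share one of its points.\<close>
    have "A \<inter> B \<inter> {0..\<kappa>} \<noteq> {}"
    proof
      assume "A \<inter> B \<inter> {0..\<kappa>} = {}"
      moreover have "{0..\<kappa>} \<subseteq> A \<union> B"
        using AB by blast
      moreover have "A \<inter> {0..\<kappa>} \<noteq> {}" "B \<inter> {0..\<kappa>} \<noteq> {}"
        using \<open>\<kappa> \<in> A\<close> \<open>0 \<in> B\<close> \<kappa>(1) by auto
      ultimately show False
        using connected_closedD[OF connected_Icc[of 0 \<kappa>], of A B] A B by blast
    qed
    then obtain k d d' where k: "0 \<le> k" and d: "opt k d" "u h \<le> ?J h d" and d': "opt k d'" "?J h d' \<le> u h"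
      by (auto simp: A_def B_def)
    \<comment> \<open>\<open>e T\<close> follows \<open>d'\<close> on \<open>T\<close> and
      \<open>d\<close> elsewhere; growing \<open>T\<close> from the empty set to \<open>S\<close>
      leads from \<open>d\<close> to \<open>d'\<close> through rules that are all optimal at price
      \<open>k\<close>.\<close>
    define e where "e T = (\<lambda>s. if s \<in> T then d' s else d s)" for T
    have e_det: "e T \<in> det" if "T \<subseteq> S" for T
      using opt_det[OF d(1)] opt_det[OF d'(1)] that by (auto simp: e_def det_def PiE_iff extensional_def)
    have e_opt: "opt k (e T)" if "T \<subseteq> S" for T
      unfolding opt_def
      by (rule bellman_opt_switch[OF l d(1)[unfolded opt_def] d'(1)[unfolded opt_def] e_det[OF that]])
        (auto simp: e_def)
    have eS: "e S = d'"
      using opt_det[OF d(1)] opt_det[OF d'(1)] by (auto simp: e_def det_def PiE_iff extensional_def)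
    show thesis
    proof (cases "u h \<le> ?J h d'")
      case True
      with d' have "?J h d' = u h" by simp
      with bound[OF d'(1) k] opt_det[OF d'(1)] show thesis
        by (intro single[of d']) auto
    next
      case False
      \<comment> \<open>The value of \<open>h\<close> starts at or above \<open>u h\<close> and ends
        below it, so some single change makes it drop below.\<close>
      have "\<exists>T t. insert t T \<subseteq> S \<and> u h \<le> ?J h (e T) \<and> ?J h (e (insert t T)) < u h"
      proof (rule ccontr)
        assume no: "\<not> ?thesis"
        have "u h \<le> ?J h (e T)" if "finite T" "T \<subseteq> S" for T
          using that
        proof (induction T rule: finite_induct)
          case empty
          with d(2) show ?case by (simp add: e_def)
        next
          case (insert t T)
          with no show ?case by force
        qed
        from this[OF finite_states[OF M] subset_refl] False eS show False by simp
      qed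
      then obtain T t where T: "insert t T \<subseteq> S" "u h \<le> ?J h (e T)" "?J h (e (insert t T)) < u h"
        by blast
      have upd: "e (insert t T) = (e T)(t := d' t)"
        by (auto simp: e_def)
      let ?a = "?J h (e T)" and ?b = "?J h ((e T)(t := d' t))"
      \<comment> \<open>The weight at which the interpolated value of \<open>h\<close> is exactly
        \<open>u h\<close>; \<open>?b\<close> lies strictly below \<open>u h\<close>, so the
        denominator is positive.\<close>
      define \<theta> where "\<theta> = (?a - u h) / (?a - ?b)"
      have ab: "?b < u h" "u h \<le> ?a"
        using T by (simp_all add: upd)
      have \<theta>: "0 \<le> \<theta>" "\<theta> \<le> 1"
        unfolding \<theta>_def using ab by (auto simp: divide_simps)
      have "\<theta> * (?a - ?b) = ?a - u h"
        unfolding \<theta>_def using ab by simp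
      then have h_eq: "(1 - \<theta>) * ?a + \<theta> * ?b = u h"
        by (simp add: algebra_simps)
      \<comment> \<open>With \<open>h\<close> met exactly, \<open>k * u h\<close> cancels from the
        weighted bound and leaves the bound on \<open>u g\<close>.\<close>
      have "(1 - \<theta>) * (u g + k * u h) + \<theta> * (u g + k * u h) \<le>
          (1 - \<theta>) * (?J g (e T) + k * ?a) + \<theta> * (?J g ((e T)(t := d' t)) + k * ?b)"
        using mult_left_mono[OF bound[OF e_opt[of T] k], of "1 - \<theta>"]
          mult_left_mono[OF bound[OF e_opt[OF T(1)] k], of \<theta>] T(1) \<theta>
        unfolding upd by (intro add_mono) auto
      also have "\<dots> = (1 - \<theta>) * ?J g (e T) + \<theta> * ?J g ((e T)(t := d' t)) + k * ((1 - \<theta>) * ?a + \<theta> * ?b)"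
        by (simp add: algebra_simps)
      finally have "u g \<le> (1 - \<theta>) * ?J g (e T) + \<theta> * ?J g ((e T)(t := d' t))"
        unfolding h_eq by (simp add: algebra_simps)
      then show thesis
        using T(1) \<theta> h_eq det_allowed[OF opt_det[OF d'(1)]] e_det
        by (intro result[of "e T" t "d' t" \<theta>]) auto
    qed
  qed
qed

section \<open>Passage to discount 1\<close>

lemma tendsto_disc_val:
  assumes "d \<in> det" "absorbing M Y"
  shows "((\<lambda>l. (1 - l) * disc_val l (indicator Y) d) \<longlongrightarrow> reach_val Y d) (at_left 1)"
proof -
  interpret K: stochastic_kernel S "det_kernel d"
    by (rule stochastic_det_kernel[OF assms(1)])
  have "indicator Y s \<le> kop S (det_kernel d) (indicator Y) s" if "s \<in> S" for s
    unfolding det_kernel_conv using det_allowed[OF assms(1)] by (intro indicator_le_kop M assms that) auto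
  then have "((\<lambda>l. \<Sum>s\<in>S. init M s * ((1 - l) * green S (det_kernel d) l (indicator Y) s)) \<longlongrightarrow>
      (\<Sum>s\<in>S. init M s * hit_val S (det_kernel d) (indicator Y) s)) (at_left 1)"
    by (intro tendsto_intros K.tendsto_green)
  then show ?thesis
    by (simp add: disc_val_def reach_val_def sum_distrib_left mult.left_commute)
qed

lemma reach_dominated:
  assumes \<pi>: "\<pi> \<in> policies M" and Y: "absorbing M Y" and Z: "absorbing M Z"
  obtains d t b \<theta> where "d \<in> det" "t \<in> S" "b \<in> allowed M t" "0 \<le> \<theta>" "\<theta> \<le> 1"
    "path_prob M \<pi> (\<lambda>\<sigma>. reaches \<sigma> Y) \<le> (1 - \<theta>) * reach_val Y d + \<theta> * reach_val Y (d(t := b))"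
    "path_prob M \<pi> (\<lambda>\<sigma>. reaches \<sigma> Z) \<le> (1 - \<theta>) * reach_val Z d + \<theta> * reach_val Z (d(t := b))"
proof -
  interpret mdp_policy M \<pi>
    by unfold_locales (rule M \<pi>)+
  define l where "l n = 1 - inverse (real (Suc (Suc n)))" for n
  have l: "0 \<le> l n" "l n < 1" for n
    by (auto simp: l_def inverse_le_1_iff)
  have l_lim: "filterlim l (at_left 1) sequentially"
  proof -
    have "l \<longlonglongrightarrow> 1 - 0"
      unfolding l_def by (intro tendsto_intros LIMSEQ_Suc[OF LIMSEQ_inverse_real_of_nat])
    with l show ?thesis
      by (intro tendsto_imp_filterlim_at_left) auto
  qed
  let ?u = "\<lambda>n W. \<Sum>i. l n ^ i * state_exp i (indicator W)"
  define good where "good n c \<theta> \<longleftrightarrow> (\<forall>W\<in>{Y, Z}. ?u n W \<le>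
      (1 - \<theta>) * disc_val (l n) (indicator W) (fst c) + \<theta> * disc_val (l n) (indicator W) (snd c))" for n c \<theta>
  define C where "C = {(d, d(t := b)) | d t b. d \<in> det \<and> t \<in> S \<and> b \<in> allowed M t}"
  have C_det: "C \<subseteq> det \<times> det"
    by (auto simp: C_def fun_upd_det)
  then have finC: "finite C"
    by (rule finite_subset) (simp add: finite_det)
  have "\<exists>c \<theta>. c \<in> C \<and> 0 \<le> \<theta> \<and> \<theta> \<le> 1 \<and> good n c \<theta>" for n
  proof -
    obtain d t b \<theta> where "d \<in> det" "t \<in> S" "b \<in> allowed M t" "0 \<le> \<theta>" "\<theta> \<le> 1"
      "?u n Y \<le> (1 - \<theta>) * disc_val (l n) (indicator Y) d + \<theta> * disc_val (l n) (indicator Y) (d(t := b))"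
      "?u n Z \<le> (1 - \<theta>) * disc_val (l n) (indicator Z) d + \<theta> * disc_val (l n) (indicator Z) (d(t := b))"
      by (rule disc_dominated[OF l[of n] \<pi>, of "indicator Y" "indicator Z"]) auto
    then show ?thesis
      by (intro exI[of _ "(d, d(t := b))"] exI[of _ \<theta>]) (auto simp: good_def C_def)
  qed
  then obtain c \<theta> where c: "\<And>n. c n \<in> C" "\<And>n. \<theta> n \<in> {0..1}" "\<And>n. good n (c n) (\<theta> n)"
    by (metis atLeastAtMost_iff)
  \<comment> \<open>Infinitely many indices share one pair of rules; along these a convergent
    subsequence of the weights is taken.\<close>
  have "\<exists>c0\<in>UNIV. infinite {n \<in> UNIV. c n = c c0}"
    using finC c(1) by (intro pigeonhole_infinite) (auto intro: finite_subset[of _ C])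
  then obtain n0 where inf: "infinite {n. c n = c n0}"
    by auto
  define r where "r = enumerate {n. c n = c n0}"
  have r: "strict_mono r" "\<And>n. c (r n) = c n0"
    using strict_mono_enumerate[OF inf] enumerate_in_set[OF inf] by (auto simp: r_def)
  have "seq_compact {0..1::real}"
    by (simp add: compact_imp_seq_compact)
  then obtain \<theta>0 r' where r': "\<theta>0 \<in> {0..1}" "strict_mono r'" "(\<theta> \<circ> r \<circ> r') \<longlonglongrightarrow> \<theta>0"
    using c(2) by (elim seq_compactE[of _ "\<theta> \<circ> r"]) auto
  define m where "m = r \<circ> r'"
  have m: "strict_mono m"
    unfolding m_def using r(1) r'(2) by (rule strict_mono_o)
  have \<theta>m: "(\<lambda>n. \<theta> (m n)) \<longlonglongrightarrow> \<theta>0"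
    using r'(3) by (simp add: m_def comp_def)
  have lm: "filterlim (\<lambda>n. l (m n)) (at_left 1) sequentially"
    using l_lim filterlim_subseq[OF m] by (rule filterlim_compose)
  obtain d t b where dtb: "c n0 = (d, d(t := b))" "d \<in> det" "t \<in> S" "b \<in> allowed M t"
    using c(1)[of n0] by (auto simp: C_def)
  have dom: "path_prob M \<pi> (\<lambda>\<sigma>. reaches \<sigma> W) \<le> (1 - \<theta>0) * reach_val W d + \<theta>0 * reach_val W (d(t := b))"
    if W: "W \<in> {Y, Z}" for W
  proof (rule LIMSEQ_le)
    have aW: "absorbing M W"
      using W Y Z by auto
    have "((\<lambda>l. (1 - l) * (\<Sum>i. l ^ i * state_exp i (indicator W))) \<longlongrightarrow>
        path_prob M \<pi> (\<lambda>\<sigma>. reaches \<sigma> W)) (at_left 1)"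
      by (intro tendsto_abel_mean incseq_SucI state_exp_le_Suc state_exp_tendsto_reach aW)
    from filterlim_compose[OF this lm]
    show "(\<lambda>n. (1 - l (m n)) * ?u (m n) W) \<longlonglongrightarrow> path_prob M \<pi> (\<lambda>\<sigma>. reaches \<sigma> W)" .
    show "(\<lambda>n. (1 - \<theta> (m n)) * ((1 - l (m n)) * disc_val (l (m n)) (indicator W) d)
          + \<theta> (m n) * ((1 - l (m n)) * disc_val (l (m n)) (indicator W) (d(t := b))))
        \<longlonglongrightarrow> (1 - \<theta>0) * reach_val W d + \<theta>0 * reach_val W (d(t := b))"
      using dtb by (intro tendsto_intros \<theta>m filterlim_compose[OF tendsto_disc_val[OF _ aW] lm] fun_upd_det)
    have "(1 - l (m n)) * ?u (m n) W \<le> (1 - \<theta> (m n)) * ((1 - l (m n)) * disc_val (l (m n)) (indicator W) d)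
          + \<theta> (m n) * ((1 - l (m n)) * disc_val (l (m n)) (indicator W) (d(t := b)))" for n
    proof -
      have "c (m n) = (d, d(t := b))"
        using r(2) dtb(1) by (simp add: m_def)
      then have "?u (m n) W \<le> (1 - \<theta> (m n)) * disc_val (l (m n)) (indicator W) d
          + \<theta> (m n) * disc_val (l (m n)) (indicator W) (d(t := b))"
        using c(3)[of "m n"] W by (auto simp: good_def)
      from mult_left_mono[OF this, of "1 - l (m n)"] l(2)[of "m n"] show ?thesis
        by (simp only: distrib_left mult.left_commute)
    qed
    then show "\<exists>N. \<forall>n\<ge>N. (1 - l (m n)) * ?u (m n) W \<le>
        (1 - \<theta> (m n)) * ((1 - l (m n)) * disc_val (l (m n)) (indicator W) d)
          + \<theta> (m n) * ((1 - l (m n)) * disc_val (l (m n)) (indicator W) (d(t := b)))"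
      by blast
  qed
  show thesis
    using dtb r'(1) dom[of Y] dom[of Z] by (intro that[of d t b \<theta>0]) auto
qed

text \<open>The kernels of \<open>d\<close> and \<open>d(t := b)\<close> agree outside row
  \<open>t\<close>, so \<open>hit_val_mix_row\<close> applies with both indicators in
  \<open>G\<close>. Its inequality holds in every start state and is then averaged over
  \<open>init\<close>.\<close>

lemma stationary_dominates_segment:
  assumes d: "d \<in> det" and t: "t \<in> S" and b: "b \<in> allowed M t" and \<theta>: "0 \<le> \<theta>" "\<theta> \<le> 1"
    and Y: "absorbing M Y" and Z: "absorbing M Z"
  obtains f where "stat_policy f \<in> policies M"
    "(1 - \<theta>) * reach_val Y d + \<theta> * reach_val Y (d(t := b)) \<le> path_prob M (stat_policy f) (\<lambda>\<sigma>. reaches \<sigma> Y)"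
    "(1 - \<theta>) * reach_val Z d + \<theta> * reach_val Z (d(t := b)) \<le> path_prob M (stat_policy f) (\<lambda>\<sigma>. reaches \<sigma> Z)"
proof -
  let ?d' = "d(t := b)"
  have d': "?d' \<in> det"
    using d t b by (rule fun_upd_det)
  interpret K: stochastic_kernel S "det_kernel d"
    by (rule stochastic_det_kernel[OF d])
  interpret K': stochastic_kernel S "det_kernel ?d'"
    by (rule stochastic_det_kernel[OF d'])
  interpret kernel_pair S "det_kernel d" "det_kernel ?d'" t
    by unfold_locales (auto simp: t det_kernel_def)
  have ind: "indicator W s \<le> kop S (det_kernel e) (indicator W) s"
    if "absorbing M W" "e \<in> det" "s \<in> S" for W e s
    unfolding det_kernel_conv using det_allowed[OF that(2)] by (intro indicator_le_kop M that) auto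
  obtain p where p: "0 \<le> p" "p \<le> 1"
    "\<And>g s. g \<in> {indicator Y, indicator Z} \<Longrightarrow> s \<in> S \<Longrightarrow>
      (1 - \<theta>) * hit_val S (det_kernel d) g s + \<theta> * hit_val S (det_kernel ?d') g s
        \<le> hit_val S (mix_row t p (det_kernel d) (det_kernel ?d')) g s"
    by (rule hit_val_mix_row[of "{indicator Y, indicator Z}" \<theta>])
      (use Y Z d d' \<theta> in \<open>auto intro: ind\<close>)
  \<comment> \<open>A Bernoulli choice with weight \<open>p\<close> on the old action
    \<open>d t\<close>, which makes the kernel of \<open>f\<close> the mixed one.\<close>
  define f where "f = (\<lambda>s. return_pmf (d s))(t := map_pmf (\<lambda>x. if x then d t else b) (bernoulli_pmf p))"
  have K_eq: "rule_kernel M f = mix_row t p (det_kernel d) (det_kernel ?d')"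
    using p(1,2) by (auto simp: fun_eq_iff rule_kernel_def f_def mix_row_def det_kernel_def)
  have supp: "set_pmf (f s) \<subseteq> allowed M s" if "s \<in> S" for s
    using that d b by (auto simp: f_def det_allowed split: if_splits)
  have dom: "(1 - \<theta>) * reach_val W d + \<theta> * reach_val W ?d' \<le> path_prob M (stat_policy f) (\<lambda>\<sigma>. reaches \<sigma> W)"
    if W: "W \<in> {Y, Z}" for W
  proof -
    have "(1 - \<theta>) * reach_val W d + \<theta> * reach_val W ?d' =
        (\<Sum>s\<in>S. init M s * ((1 - \<theta>) * hit_val S (det_kernel d) (indicator W) s
          + \<theta> * hit_val S (det_kernel ?d') (indicator W) s))"
      by (simp add: reach_val_def sum_distrib_left sum.distrib distrib_left mult.left_commute)
    also have "\<dots> \<le> (\<Sum>s\<in>S. init M s * hit_val S (rule_kernel M f) (indicator W) s)"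
      unfolding K_eq using W p(3) by (intro sum_mono mult_left_mono init_nonneg[OF M]) auto
    also have "\<dots> = path_prob M (stat_policy f) (\<lambda>\<sigma>. reaches \<sigma> W)"
      using W Y Z by (intro path_prob_stat_policy[symmetric] M supp) auto
    finally show ?thesis .
  qed
  show thesis
    using supp dom by (intro that[of f]) (auto simp: stat_policy_in_policies)
qed

text \<open>The points of \<open>A\<close> need not be values of stationary policies. It suffices
  that \<open>A\<close> dominates every feasible policy and that each of its points is dominated by
  a stationary one: the best point of \<open>A\<close> under the constraint then yields an optimal
  policy.\<close>

lemma ex_stationary_reach_optimal:
  assumes Y: "absorbing M Y" and Z: "absorbing M Z"
    and feas: "feasible M (\<lambda>\<sigma>. reaches \<sigma> Z) \<tau> \<pi>"
  shows "\<exists>f. reach_optimal M Y Z \<tau> (stat_policy f)"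
proof -
  define C where "C = {(d, d(t := b)) | d t b. d \<in> det \<and> t \<in> S \<and> b \<in> allowed M t}"
  have "C \<subseteq> det \<times> det"
    by (auto simp: C_def fun_upd_det)
  then have finC: "finite C"
    by (rule finite_subset) (simp add: finite_det)
  define v where "v c = (\<lambda>\<theta>. ((1 - \<theta>) * reach_val Y (fst c) + \<theta> * reach_val Y (snd c),
      (1 - \<theta>) * reach_val Z (fst c) + \<theta> * reach_val Z (snd c)))" for c
  define A where "A = (\<Union>c\<in>C. v c ` {0..1})"
  have "compact A"
    unfolding A_def v_def using finC
    by (intro compact_UN compact_continuous_image continuous_intros) auto
  moreover have "closed {x :: real \<times> real. \<tau> \<le> snd x}"
    by (intro closed_Collect_le continuous_intros)
  ultimately have compact: "compact (A \<inter> {x. \<tau> \<le> snd x})"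
    by (rule compact_Int_closed)
  have dom: "\<exists>x\<in>A \<inter> {x. \<tau> \<le> snd x}. path_prob M \<pi> (\<lambda>\<sigma>. reaches \<sigma> Y) \<le> fst x"
    if feas: "feasible M (\<lambda>\<sigma>. reaches \<sigma> Z) \<tau> \<pi>" for \<pi>
  proof -
    have \<pi>: "\<pi> \<in> policies M" "\<tau> \<le> path_prob M \<pi> (\<lambda>\<sigma>. reaches \<sigma> Z)"
      using feas by (auto simp: feasible_def)
    obtain d t b \<theta> where "d \<in> det" "t \<in> S" "b \<in> allowed M t" "0 \<le> \<theta>" "\<theta> \<le> 1"
      "path_prob M \<pi> (\<lambda>\<sigma>. reaches \<sigma> Y) \<le> (1 - \<theta>) * reach_val Y d + \<theta> * reach_val Y (d(t := b))"
      "path_prob M \<pi> (\<lambda>\<sigma>. reaches \<sigma> Z) \<le> (1 - \<theta>) * reach_val Z d + \<theta> * reach_val Z (d(t := b))"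
      using reach_dominated[OF \<pi>(1) Y Z] .
    moreover from this have "(d, d(t := b)) \<in> C" "\<theta> \<in> {0..1}"
      by (auto simp: C_def)
    then have "v (d, d(t := b)) \<theta> \<in> A"
      unfolding A_def by blast
    ultimately show ?thesis
      using \<pi>(2) by (intro bexI[of _ "v (d, d(t := b)) \<theta>"]) (auto simp: v_def)
  qed
  have "A \<inter> {x. \<tau> \<le> snd x} \<noteq> {}"
    using dom[OF feas] by blast
  from continuous_attains_sup[OF compact this continuous_on_fst[OF continuous_on_id]]
  obtain x where x: "x \<in> A" "\<tau> \<le> snd x" "\<And>y. y \<in> A \<Longrightarrow> \<tau> \<le> snd y \<Longrightarrow> fst y \<le> fst x"
    by blast
  then obtain d t b \<theta> where dtb: "d \<in> det" "t \<in> S" "b \<in> allowed M t" "0 \<le> \<theta>" "\<theta> \<le> 1"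
    and x_eq: "x = v (d, d(t := b)) \<theta>"
    by (auto simp: A_def C_def)
  obtain f where f: "stat_policy f \<in> policies M"
    "fst x \<le> path_prob M (stat_policy f) (\<lambda>\<sigma>. reaches \<sigma> Y)"
    "snd x \<le> path_prob M (stat_policy f) (\<lambda>\<sigma>. reaches \<sigma> Z)"
    using stationary_dominates_segment[OF dtb Y Z] by (auto simp: x_eq v_def)
  have "path_prob M \<pi>' (\<lambda>\<sigma>. reaches \<sigma> Y) \<le> path_prob M (stat_policy f) (\<lambda>\<sigma>. reaches \<sigma> Y)"
    if "feasible M (\<lambda>\<sigma>. reaches \<sigma> Z) \<tau> \<pi>'" for \<pi>'
    using dom[OF that] x(3) f(2) by force
  with f x(2) show ?thesis
    by (auto simp: reach_optimal_def optimal_def feasible_def)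
qed

end

section \<open>Transfer between the LMDP and the double product\<close>

text \<open>\<open>run\<close> consumes words from the front, whereas prefixes of trajectories grow
  at the end.\<close>

lemma run_snoc: "run D q (w @ [l]) = Option.bind (run D q w) (\<lambda>q'. delta D q' l)"
  by (induction w arbitrary: q) (auto split: bind_split)

lemma lift_prefix_Nil [simp]: "lift_prefix M D1 D2 [] = []"
  by (simp add: lift_prefix_def)

lemma length_lift_prefix [simp]: "length (lift_prefix M D1 D2 h) = length h"
  by (simp add: lift_prefix_def)

lemma lift_prefix_eq_Nil_iff [simp]: "lift_prefix M D1 D2 h = [] \<longleftrightarrow> h = []"
  by (simp flip: length_0_conv)

lemma lift_prefix_snoc:
  "lift_prefix M D1 D2 (h @ [(s, a)]) = lift_prefix M D1 D2 h @ [(lift_state M D1 D2 h s, a)]"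
  by (simp add: lift_prefix_def nth_append)

text \<open>A left inverse of lifting; \<open>'q\<close> stands for the pair of automaton
  states.\<close>

definition proj_prefix :: "(('s \<times> 'q) \<times> 'a) list \<Rightarrow> ('s \<times> 'a) list" where
  "proj_prefix = map (\<lambda>(x, a). (fst x, a))"

lemma proj_lift_prefix [simp]: "proj_prefix (lift_prefix M D1 D2 h) = h"
  by (induction h rule: rev_induct)
    (auto simp: proj_prefix_def lift_prefix_snoc lift_state_def Let_def)

lemma set_lift_prefix_map:
  "set (lift_prefix M D1 D2 (map \<omega> [0..<n])) =
    (\<lambda>i. (lift_state M D1 D2 (map \<omega> [0..<i]) (fst (\<omega> i)), snd (\<omega> i))) ` {..<n}"
  by (auto simp: lift_prefix_def take_map image_iff)

definition lift_policy :: "('s, 'a) policy \<Rightarrow> ('s \<times> 'q, 'a) policy" where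
  "lift_policy \<pi> k x t = \<pi> (proj_prefix k) (fst x) t"

text \<open>Every policy of the LMDP is thus a recovered one, so transferring probabilities for
  recovered policies covers both directions.\<close>

lemma recovered_lift_policy: "recovered_policy M D1 D2 (lift_policy \<pi>) = \<pi>"
  by (simp add: fun_eq_iff recovered_policy_def lift_policy_def lift_state_def Let_def)

lemma fst_state_actions: "x \<in> state_actions M \<Longrightarrow> fst x \<in> states M"
  by (auto simp: state_actions_def)

section \<open>Prefixes of the LMDP inside the product\<close>

locale product =
  fixes M :: "('s, 'a, 'p) lmdp"
    and D1 :: "('q1, 'p set) dfa" and D2 :: "('q2, 'p set) dfa"
  assumes lmdp: "is_lmdp M"
    and dfa1: "is_dfa D1" "alphabet D1 = Pow (props M)"
    and dfa2: "is_dfa D2" "alphabet D2 = Pow (props M)"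
    and final1: "\<And>q l. q \<in> final D1 \<Longrightarrow> l \<in> alphabet D1 \<Longrightarrow> delta D1 q l = Some q"
    and final2: "\<And>q l. q \<in> final D2 \<Longrightarrow> l \<in> alphabet D2 \<Longrightarrow> delta D2 q l = Some q"
    and X: "is_mdp (double_product M D1 D2)"
begin

abbreviation "X \<equiv> double_product M D1 D2"
abbreviation "lp \<equiv> lift_prefix M D1 D2"
abbreviation "ls \<equiv> lift_state M D1 D2"
abbreviation "labels \<equiv> map (\<lambda>(s', a). label M s')"

lemma M: "is_mdp M"
  using lmdp by (simp add: is_lmdp_def)

lemma label_alphabet: "s \<in> states M \<Longrightarrow> label M s \<in> alphabet D1" "s \<in> states M \<Longrightarrow> label M s \<in> alphabet D2"
  using lmdp dfa1 dfa2 by (auto simp: is_lmdp_def)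

lemma states_X: "states X = states M \<times> dstates D1 \<times> dstates D2"
  by (simp add: double_product_def)

lemma state_actions_X:
  "((s, q1, q2), a) \<in> state_actions X \<longleftrightarrow>
    (s, a) \<in> state_actions M \<and> q1 \<in> dstates D1 \<and> q2 \<in> dstates D2"
  by (auto simp: state_actions_def double_product_def)

lemma dinit_mem: "dinit D1 \<in> dstates D1" "dinit D2 \<in> dstates D2"
  using dfa1 dfa2 by (auto simp: is_dfa_def)

text \<open>A row of the product that sums to 1 has a successor of nonzero probability, which exists
  only if both automata can read the label. This is how the partial transition functions become
  defined where they are used.\<close>

lemma delta_defined:
  assumes "(s, a) \<in> state_actions M" "q1 \<in> dstates D1" "q2 \<in> dstates D2"
  shows "\<exists>q1'\<in>dstates D1. \<exists>q2'\<in>dstates D2.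
    delta D1 q1 (label M s) = Some q1' \<and> delta D2 q2 (label M s) = Some q2'"
proof -
  have "(\<Sum>x\<in>states X. trans X (s, q1, q2) a x) = 1"
    using assms by (intro trans_sum[OF X]) (auto simp: state_actions_def double_product_def)
  then have "(\<Sum>x\<in>states X. trans X (s, q1, q2) a x) \<noteq> 0"
    by simp
  then obtain x where "x \<in> states X" "trans X (s, q1, q2) a x \<noteq> 0"
    by (rule sum.not_neutral_contains_not_neutral)
  then show ?thesis
    by (cases x) (auto simp: double_product_def split: if_splits)
qed

lemma run_defined:
  assumes "h \<in> lists (state_actions M)"
  shows "\<exists>q1\<in>dstates D1. \<exists>q2\<in>dstates D2.
    run D1 (dinit D1) (labels h) = Some q1 \<and> run D2 (dinit D2) (labels h) = Some q2"
  using assms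
proof (induction h rule: rev_induct)
  case Nil
  show ?case by (simp add: dinit_mem)
next
  case (snoc x h)
  obtain s a where x: "x = (s, a)" by force
  from snoc obtain q1 q2 where "q1 \<in> dstates D1" "q2 \<in> dstates D2"
    "run D1 (dinit D1) (labels h) = Some q1" "run D2 (dinit D2) (labels h) = Some q2"
    by auto
  with snoc.prems delta_defined[of s a q1 q2] show ?case
    by (auto simp: x run_snoc)
qed

lemma lift_state_mem: "h \<in> lists (state_actions M) \<Longrightarrow> s \<in> states M \<Longrightarrow> ls h s \<in> states X"
  using run_defined[of h] by (auto simp: lift_state_def states_X)

lemma lift_prefix_mem: "h \<in> lists (state_actions M) \<Longrightarrow> lp h \<in> lists (state_actions X)"
proof (induction h rule: rev_induct)
  case (snoc x h)
  obtain s a where x: "x = (s, a)" by force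
  have "(s, a) \<in> state_actions M" "h \<in> lists (state_actions M)"
    using snoc.prems by (auto simp: x)
  with snoc.IH run_defined[of h] show ?case
    by (auto simp: x lift_prefix_snoc lift_state_def state_actions_X)
qed simp

lemma proj_prefix_mem: "k \<in> lists (state_actions X) \<Longrightarrow> proj_prefix k \<in> lists (state_actions M)"
  by (fastforce simp: proj_prefix_def state_actions_X)

lemma recovered_policy_mem:
  assumes "\<pi> \<in> policies X"
  shows "recovered_policy M D1 D2 \<pi> \<in> policies M"
proof -
  have "set_pmf (\<pi> (lp h) (ls h s) (length h)) \<subseteq> allowed M s"
    if "h \<in> lists (state_actions M)" "s \<in> states M" for h s
    using policies_supp[OF assms lift_prefix_mem[OF that(1)] lift_state_mem[OF that]]
    by (simp add: double_product_def lift_state_def Let_def)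
  then show ?thesis
    by (simp add: policies_def recovered_policy_def)
qed

lemma lift_policy_mem:
  assumes "\<pi> \<in> policies M"
  shows "lift_policy \<pi> \<in> policies X"
proof -
  have "set_pmf (lift_policy \<pi> k x (length k)) \<subseteq> allowed X x"
    if "k \<in> lists (state_actions X)" "x \<in> states X" for k x
    using policies_supp[OF assms proj_prefix_mem[OF that(1)], of "fst x"] that(2)
    by (auto simp: lift_policy_def double_product_def proj_prefix_def)
  then show ?thesis
    by (auto simp: policies_def)
qed

text \<open>The product moves its automata by the label of the state that is left, and
  \<open>lift_state\<close> has read exactly the labels before the current state. The lifted step
  thus meets the automaton condition and keeps its probability; at time 0 both automata are in their
  initial states.\<close>

lemma step_prob_lift:
  assumes h: "h \<in> lists (state_actions M)"
  shows "step_prob X \<pi> (lp h) (ls h s, a) = step_prob M (recovered_policy M D1 D2 \<pi>) h (s, a)"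
proof (cases h rule: rev_cases)
  case Nil
  then show ?thesis
    by (simp add: step_prob_def recovered_policy_def lift_state_def double_product_def)
next
  case (snoc h' x)
  obtain s' a' where x: "x = (s', a')" by force
  have h': "h' \<in> lists (state_actions M)" "(s', a') \<in> state_actions M"
    using h snoc x by auto
  obtain q1 q2 where q: "q1 \<in> dstates D1" "q2 \<in> dstates D2"
    "run D1 (dinit D1) (labels h') = Some q1" "run D2 (dinit D2) (labels h') = Some q2"
    using run_defined[OF h'(1)] by auto
  obtain q1' q2' where q': "delta D1 q1 (label M s') = Some q1'" "delta D2 q2 (label M s') = Some q2'"
    using delta_defined[OF h'(2) q(1,2)] by auto
  have ls: "ls h s = (s, q1', q2')" and ls': "ls h' s' = (s', q1, q2)"
    using q q' by (simp_all add: snoc x lift_state_def run_snoc)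
  have last: "last (lp h) = (ls h' s', a')"
    by (simp add: snoc x lift_prefix_snoc)
  have "trans X (ls h' s') a' (ls h s) = trans M s' a' s"
    using q' by (simp add: ls ls' double_product_def)
  moreover have "fst (last h) = s'" "snd (last h) = a'" "h \<noteq> []"
    by (simp_all add: snoc x)
  ultimately show ?thesis
    by (simp add: step_prob_def last recovered_policy_def)
qed

lemma prefix_prob_lift:
  "h \<in> lists (state_actions M) \<Longrightarrow>
    prefix_prob X \<pi> (lp h) = prefix_prob M (recovered_policy M D1 D2 \<pi>) h"
proof (induction h rule: rev_induct)
  case (snoc x h)
  obtain s a where x: "x = (s, a)" by force
  show ?case
    using snoc by (simp add: x lift_prefix_snoc prefix_prob_snoc step_prob_lift)
qed simp

text \<open>The automaton components of a product prefix are determined by its \<open>M\<close>-part, except for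
  prefixes of probability zero.\<close>

lemma lift_proj_prefix:
  "k \<in> lists (state_actions X) \<Longrightarrow> prefix_prob X \<pi> k \<noteq> 0 \<Longrightarrow> lp (proj_prefix k) = k"
proof (induction k rule: rev_induct)
  case Nil
  show ?case by (simp add: proj_prefix_def)
next
  case (snoc x k)
  obtain s q1 q2 a where x: "x = ((s, q1, q2), a)" by (metis prod.exhaust)
  have k: "k \<in> lists (state_actions X)"
    using snoc.prems by auto
  define h where "h = proj_prefix k"
  have lph: "lp h = k"
    using snoc by (auto simp: h_def prefix_prob_snoc)
  have h: "h \<in> lists (state_actions M)"
    unfolding h_def by (rule proj_prefix_mem[OF k])
  have step: "step_prob X \<pi> k x \<noteq> 0"
    using snoc.prems by (auto simp: prefix_prob_snoc)
  have "ls h s = (s, q1, q2)"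
  proof (cases h rule: rev_cases)
    case Nil
    with lph have "k = []" by simp
    with step Nil show ?thesis
      by (auto simp: step_prob_def x double_product_def lift_state_def split: if_splits)
  next
    case (snoc h' y)
    obtain s' a' where y: "y = (s', a')" by force
    obtain r1 r2 where r: "run D1 (dinit D1) (labels h') = Some r1" "run D2 (dinit D2) (labels h') = Some r2"
      using run_defined[of h'] h snoc by auto
    have "last k = ((s', r1, r2), a')" "k \<noteq> []"
      using r by (auto simp: lph[symmetric] snoc y lift_prefix_snoc lift_state_def)
    with step have "delta D1 r1 (label M s') = Some q1" "delta D2 r2 (label M s') = Some q2"
      by (auto simp: step_prob_def x double_product_def split: if_splits)
    with r show ?thesis
      by (simp add: snoc y lift_state_def run_snoc)
  qed
  then have "lp (h @ [(s, a)]) = k @ [x]"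
    by (simp add: lift_prefix_snoc lph x)
  then show ?case
    by (simp add: proj_prefix_def h_def x)
qed

text \<open>Lifting is injective, with \<open>proj_prefix\<close> as left inverse, and prefixes
  outside its image have probability zero.\<close>

lemma sum_prefixes_lift:
  "(\<Sum>k\<in>prefixes X n. prefix_prob X \<pi> k * f k) =
    (\<Sum>h\<in>prefixes M n. prefix_prob M (recovered_policy M D1 D2 \<pi>) h * f (lp h))"
proof -
  have "(\<Sum>k\<in>prefixes X n. prefix_prob X \<pi> k * f k) = (\<Sum>k\<in>lp ` prefixes M n. prefix_prob X \<pi> k * f k)"
  proof (rule sum.mono_neutral_right)
    show "finite (prefixes X n)"
      by (rule finite_prefixes[OF X])
    show "lp ` prefixes M n \<subseteq> prefixes X n"
      using lift_prefix_mem by (auto simp: prefixes_def)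
    show "\<forall>k\<in>prefixes X n - lp ` prefixes M n. prefix_prob X \<pi> k * f k = 0"
    proof (intro ballI, rule ccontr)
      fix k assume k: "k \<in> prefixes X n - lp ` prefixes M n" and "prefix_prob X \<pi> k * f k \<noteq> 0"
      then have "lp (proj_prefix k) = k"
        by (intro lift_proj_prefix[of _ \<pi>]) (auto simp: prefixes_def)
      moreover have "proj_prefix k \<in> prefixes M n"
        using k proj_prefix_mem[of k] by (auto simp: prefixes_def proj_prefix_def)
      ultimately show False
        using k by (metis DiffD2 imageI)
    qed
  qed
  also have "\<dots> = (\<Sum>h\<in>prefixes M n. prefix_prob X \<pi> (lp h) * f (lp h))"
    by (subst sum.reindex) (auto intro!: inj_on_inverseI[where g = proj_prefix])
  also have "\<dots> = (\<Sum>h\<in>prefixes M n. prefix_prob M (recovered_policy M D1 D2 \<pi>) h * f (lp h))"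
    by (intro sum.cong) (auto simp: prefixes_def prefix_prob_lift)
  finally show ?thesis .
qed

text \<open>At each length the finite sums of the two models agree, hence so do their
  limits.\<close>

lemma path_prob_lift:
  assumes \<pi>: "\<pi> \<in> policies X"
    and E: "\<And>\<omega>. range \<omega> \<subseteq> state_actions M \<Longrightarrow>
      E (\<lambda>t. fst (\<omega> t)) \<longleftrightarrow> (\<exists>i. ls (map \<omega> [0..<i]) (fst (\<omega> i)) \<in> T)"
  shows "path_prob M (recovered_policy M D1 D2 \<pi>) E = path_prob X \<pi> (\<lambda>\<sigma>. reaches \<sigma> T)"
proof -
  interpret P: mdp_policy X \<pi>
    by unfold_locales (rule X \<pi>)+
  interpret R: mdp_policy M "recovered_policy M D1 D2 \<pi>"
    by unfold_locales (rule M recovered_policy_mem[OF \<pi>])+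
  let ?Q = "\<lambda>h. \<exists>x\<in>set (lp h). fst x \<in> T"
  have "(\<lambda>n. \<Sum>h\<in>prefixes M n. prefix_prob M (recovered_policy M D1 D2 \<pi>) h * of_bool (?Q h))
      \<longlonglongrightarrow> path_prob M (recovered_policy M D1 D2 \<pi>) E"
  proof (rule R.path_prob_tendsto)
    show "?Q (map \<omega> [0..<n])" if "m \<le> n" "?Q (map \<omega> [0..<m])" for \<omega> m n
      using that by (auto simp: set_lift_prefix_map intro: less_le_trans)
    show "E (\<lambda>t. fst (\<omega> t)) \<longleftrightarrow> (\<exists>n. ?Q (map \<omega> [0..<n]))" if "range \<omega> \<subseteq> state_actions M" for \<omega>
      using E[OF that] by (auto simp: set_lift_prefix_map)
  qed
  then show ?thesis
    using P.reach_prefix_tendsto[of T] by (simp only: sum_prefixes_lift) (rule LIMSEQ_unique)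
qed

section \<open>Acceptance and the target sets\<close>

text \<open>The automaton state of the product at time \<open>i\<close> has read one label less than the acceptance
  condition at time \<open>i\<close>; since final states are absorbing, the shift is immaterial.\<close>

lemma accepts_iff:
  assumes final: "\<And>q s. q \<in> final D \<Longrightarrow> s \<in> states M \<Longrightarrow> delta D q (label M s) = Some q"
    and run: "\<And>i. run D (dinit D) (map (\<lambda>j. label M (\<sigma> j)) [0..<i]) \<noteq> None"
    and \<sigma>: "\<And>i. \<sigma> i \<in> states M"
  shows "accepts M D \<sigma> \<longleftrightarrow> (\<exists>i. the (run D (dinit D) (map (\<lambda>j. label M (\<sigma> j)) [0..<i])) \<in> final D)"
proof
  assume "accepts M D \<sigma>"
  then show "\<exists>i. the (run D (dinit D) (map (\<lambda>j. label M (\<sigma> j)) [0..<i])) \<in> final D"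
    unfolding accepts_def by (metis option.sel)
next
  assume "\<exists>i. the (run D (dinit D) (map (\<lambda>j. label M (\<sigma> j)) [0..<i])) \<in> final D"
  then obtain i where i: "the (run D (dinit D) (map (\<lambda>j. label M (\<sigma> j)) [0..<i])) \<in> final D" ..
  with run[of i] obtain q where "run D (dinit D) (map (\<lambda>j. label M (\<sigma> j)) [0..<i]) = Some q" "q \<in> final D"
    by auto
  then show "accepts M D \<sigma>"
    unfolding accepts_def using final[of q "\<sigma> i"] \<sigma>
    by (intro exI[of _ i] bexI[of _ q]) (simp_all add: run_snoc)
qed

lemma accepts_iff_target:
  assumes \<omega>: "range \<omega> \<subseteq> state_actions M"
  shows "accepts M D1 (\<lambda>t. fst (\<omega> t)) \<longleftrightarrow> (\<exists>i. ls (map \<omega> [0..<i]) (fst (\<omega> i)) \<in> target1 M D1 D2)"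
    and "accepts M D2 (\<lambda>t. fst (\<omega> t)) \<longleftrightarrow> (\<exists>i. ls (map \<omega> [0..<i]) (fst (\<omega> i)) \<in> target2 M D1 D2)"
proof -
  have h: "map \<omega> [0..<i] \<in> lists (state_actions M)" for i
    using range_subsetD[OF \<omega>] by (auto simp del: split_paired_All)
  have s: "fst (\<omega> i) \<in> states M" for i
    using range_subsetD[OF \<omega>] by (rule fst_state_actions)
  have lab: "labels (map \<omega> [0..<i]) = map (\<lambda>j. label M (fst (\<omega> j))) [0..<i]" for i
    by (simp add: case_prod_beta)
  note def = run_defined[OF h, unfolded lab]
  have t: "ls (map \<omega> [0..<i]) (fst (\<omega> i)) \<in> target1 M D1 D2 \<longleftrightarrow>
      the (run D1 (dinit D1) (map (\<lambda>j. label M (fst (\<omega> j))) [0..<i])) \<in> final D1"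
    "ls (map \<omega> [0..<i]) (fst (\<omega> i)) \<in> target2 M D1 D2 \<longleftrightarrow>
      the (run D2 (dinit D2) (map (\<lambda>j. label M (fst (\<omega> j))) [0..<i])) \<in> final D2" for i
    using lift_state_mem[OF h s, of i i]
    by (auto simp: target1_def target2_def lift_state_def Let_def lab simp del: map_map)
  show "accepts M D1 (\<lambda>t. fst (\<omega> t)) \<longleftrightarrow> (\<exists>i. ls (map \<omega> [0..<i]) (fst (\<omega> i)) \<in> target1 M D1 D2)"
    unfolding t using def final1 label_alphabet s by (intro accepts_iff) (fastforce+)
  show "accepts M D2 (\<lambda>t. fst (\<omega> t)) \<longleftrightarrow> (\<exists>i. ls (map \<omega> [0..<i]) (fst (\<omega> i)) \<in> target2 M D1 D2)"
    unfolding t using def final2 label_alphabet s by (intro accepts_iff) (fastforce+)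
qed

text \<open>A nonzero transition moves each automaton component by \<open>delta\<close>, which fixes
  final states.\<close>

lemma absorbing_targets: "absorbing X (target1 M D1 D2)" "absorbing X (target2 M D1 D2)"
  using final1 final2 label_alphabet
  by (fastforce simp: absorbing_def target1_def target2_def double_product_def state_actions_def
      split: if_splits)+

lemma path_prob_models:
  assumes \<pi>: "\<pi> \<in> policies X"
    and rep: "represents M D1 \<phi>" "represents M D2 \<psi>"
  shows "path_prob M (recovered_policy M D1 D2 \<pi>) (\<lambda>\<sigma>. path_models M \<sigma> \<phi>) =
      path_prob X \<pi> (\<lambda>\<sigma>. reaches \<sigma> (target1 M D1 D2))"
    and "path_prob M (recovered_policy M D1 D2 \<pi>) (\<lambda>\<sigma>. path_models M \<sigma> \<psi>) =
      path_prob X \<pi> (\<lambda>\<sigma>. reaches \<sigma> (target2 M D1 D2))"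
proof -
  have states: "range (\<lambda>t. fst (\<omega> t)) \<subseteq> states M" if "range \<omega> \<subseteq> state_actions M" for \<omega> :: "nat \<Rightarrow> 's \<times> 'a"
    using fst_state_actions[OF range_subsetD[OF that]] by auto
  have acc: "path_models M \<sigma> \<phi> = accepts M D1 \<sigma>" "path_models M \<sigma> \<psi> = accepts M D2 \<sigma>"
    if "range \<sigma> \<subseteq> states M" for \<sigma>
    using rep that unfolding represents_def by blast+
  show "path_prob M (recovered_policy M D1 D2 \<pi>) (\<lambda>\<sigma>. path_models M \<sigma> \<phi>) =
      path_prob X \<pi> (\<lambda>\<sigma>. reaches \<sigma> (target1 M D1 D2))"
  proof (rule path_prob_lift[OF \<pi>])
    fix \<omega> :: "nat \<Rightarrow> 's \<times> 'a" assume \<omega>: "range \<omega> \<subseteq> state_actions M"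
    show "path_models M (\<lambda>t. fst (\<omega> t)) \<phi> \<longleftrightarrow> (\<exists>i. ls (map \<omega> [0..<i]) (fst (\<omega> i)) \<in> target1 M D1 D2)"
      unfolding acc(1)[OF states[OF \<omega>]] by (rule accepts_iff_target(1)[OF \<omega>])
  qed
  show "path_prob M (recovered_policy M D1 D2 \<pi>) (\<lambda>\<sigma>. path_models M \<sigma> \<psi>) =
      path_prob X \<pi> (\<lambda>\<sigma>. reaches \<sigma> (target2 M D1 D2))"
  proof (rule path_prob_lift[OF \<pi>])
    fix \<omega> :: "nat \<Rightarrow> 's \<times> 'a" assume \<omega>: "range \<omega> \<subseteq> state_actions M"
    show "path_models M (\<lambda>t. fst (\<omega> t)) \<psi> \<longleftrightarrow> (\<exists>i. ls (map \<omega> [0..<i]) (fst (\<omega> i)) \<in> target2 M D1 D2)"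
      unfolding acc(2)[OF states[OF \<omega>]] by (rule accepts_iff_target(2)[OF \<omega>])
  qed
qed

end

theorem lemma1:
  fixes M :: "('s, 'a, 'p) lmdp"
    and \<phi> \<psi> :: "'p ltl"
    and \<tau> :: real
    and D\<^sub>\<phi> :: "('q1, 'p set) dfa"
    and D\<^sub>\<psi> :: "('q2, 'p set) dfa"
  assumes "is_lmdp M"
    and "sc_ltl (props M) \<phi>" and "sc_ltl (props M) \<psi>"
    and "represents M D\<^sub>\<phi> \<phi>" and "represents M D\<^sub>\<psi> \<psi>"
    and "is_mdp (double_product M D\<^sub>\<phi> D\<^sub>\<psi>)"
  shows "((\<exists>\<pi>. feasible M (\<lambda>\<sigma>. path_models M \<sigma> \<psi>) \<tau> \<pi>) \<longrightarrow>
          (\<exists>\<pi>\<^sub>x. stationary (double_product M D\<^sub>\<phi> D\<^sub>\<psi>) \<pi>\<^sub>x \<and>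
             reach_optimal (double_product M D\<^sub>\<phi> D\<^sub>\<psi>)
               (target1 M D\<^sub>\<phi> D\<^sub>\<psi>) (target2 M D\<^sub>\<phi> D\<^sub>\<psi>) \<tau> \<pi>\<^sub>x)) \<and>
         (\<forall>\<pi>\<^sub>x. stationary (double_product M D\<^sub>\<phi> D\<^sub>\<psi>) \<pi>\<^sub>x \<and>
             reach_optimal (double_product M D\<^sub>\<phi> D\<^sub>\<psi>)
               (target1 M D\<^sub>\<phi> D\<^sub>\<psi>) (target2 M D\<^sub>\<phi> D\<^sub>\<psi>) \<tau> \<pi>\<^sub>x \<longrightarrow>
           ltl_optimal M \<phi> \<psi> \<tau> (recovered_policy M D\<^sub>\<phi> D\<^sub>\<psi> \<pi>\<^sub>x))"
proof -
  interpret product M D\<^sub>\<phi> D\<^sub>\<psi>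
    using assms by unfold_locales (auto simp: represents_def)
  note models = path_prob_models[OF _ assms(4,5)]
  \<comment> \<open>\<open>models\<close> is applied to a lifted policy, whose recovered policy is
    the original one.\<close>
  have lift: "lift_policy \<pi> \<in> policies X"
    "path_prob X (lift_policy \<pi>) (\<lambda>\<sigma>. reaches \<sigma> (target1 M D\<^sub>\<phi> D\<^sub>\<psi>)) = path_prob M \<pi> (\<lambda>\<sigma>. path_models M \<sigma> \<phi>)"
    "path_prob X (lift_policy \<pi>) (\<lambda>\<sigma>. reaches \<sigma> (target2 M D\<^sub>\<phi> D\<^sub>\<psi>)) = path_prob M \<pi> (\<lambda>\<sigma>. path_models M \<sigma> \<psi>)"
    if "\<pi> \<in> policies M" for \<pi>
    using lift_policy_mem[OF that] models[of "lift_policy \<pi>"] by (simp_all add: recovered_lift_policy)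
  show ?thesis
  proof (intro conjI impI allI)
    assume "\<exists>\<pi>. feasible M (\<lambda>\<sigma>. path_models M \<sigma> \<psi>) \<tau> \<pi>"
    then obtain \<pi> where \<pi>: "\<pi> \<in> policies M" and feas: "\<tau> \<le> path_prob M \<pi> (\<lambda>\<sigma>. path_models M \<sigma> \<psi>)"
      by (auto simp: feasible_def)
    \<comment> \<open>The lifted policy is a policy of the product, hence every product state has an
      allowed action.\<close>
    interpret live_mdp X
    proof
      fix x assume "x \<in> states X"
      then show "allowed X x \<noteq> {}"
        using policies_supp[OF lift(1)[OF \<pi>] lists.Nil, of x] set_pmf_not_empty by fastforce
    qed (rule X)
    have "feasible X (\<lambda>\<sigma>. reaches \<sigma> (target2 M D\<^sub>\<phi> D\<^sub>\<psi>)) \<tau> (lift_policy \<pi>)"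
      using lift[OF \<pi>] feas by (simp add: feasible_def)
    from ex_stationary_reach_optimal[OF absorbing_targets this]
    show "\<exists>\<pi>\<^sub>x. stationary X \<pi>\<^sub>x \<and> reach_optimal X (target1 M D\<^sub>\<phi> D\<^sub>\<psi>) (target2 M D\<^sub>\<phi> D\<^sub>\<psi>) \<tau> \<pi>\<^sub>x"
      using stationary_stat_policy by blast
  next
    fix \<pi>\<^sub>x
    assume "stationary X \<pi>\<^sub>x \<and> reach_optimal X (target1 M D\<^sub>\<phi> D\<^sub>\<psi>) (target2 M D\<^sub>\<phi> D\<^sub>\<psi>) \<tau> \<pi>\<^sub>x"
    then have opt: "reach_optimal X (target1 M D\<^sub>\<phi> D\<^sub>\<psi>) (target2 M D\<^sub>\<phi> D\<^sub>\<psi>) \<tau> \<pi>\<^sub>x"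
      by simp
    then have "\<pi>\<^sub>x \<in> policies X"
      by (simp add: reach_optimal_def optimal_def feasible_def)
    note eqs = models[OF this] and mem = recovered_policy_mem[OF this]
    \<comment> \<open>A competitor is lifted and optimality in the product is applied to the lift;
      equality of the probabilities carries the inequality back.\<close>
    have "path_prob M \<pi> (\<lambda>\<sigma>. path_models M \<sigma> \<phi>) \<le> path_prob X \<pi>\<^sub>x (\<lambda>\<sigma>. reaches \<sigma> (target1 M D\<^sub>\<phi> D\<^sub>\<psi>))"
      if "feasible M (\<lambda>\<sigma>. path_models M \<sigma> \<psi>) \<tau> \<pi>" for \<pi>
    proof -
      have \<pi>: "\<pi> \<in> policies M" and "\<tau> \<le> path_prob M \<pi> (\<lambda>\<sigma>. path_models M \<sigma> \<psi>)"
        using that by (simp_all add: feasible_def)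
      then have "feasible X (\<lambda>\<sigma>. reaches \<sigma> (target2 M D\<^sub>\<phi> D\<^sub>\<psi>)) \<tau> (lift_policy \<pi>)"
        using lift[OF \<pi>] by (simp add: feasible_def)
      then show ?thesis
        using opt lift(2)[OF \<pi>] by (auto simp: reach_optimal_def optimal_def)
    qed
    with opt mem show "ltl_optimal M \<phi> \<psi> \<tau> (recovered_policy M D\<^sub>\<phi> D\<^sub>\<psi> \<pi>\<^sub>x)"
      by (simp add: ltl_optimal_def reach_optimal_def optimal_def feasible_def eqs)
  qed
qed

end
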